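(* Let $G=(V,E)$ be a graph, let $m\ge d\ge 1$, and let $V_1,\dots,V_m$ be a partition of $V$ into nonempty sets. Assume that the reduced graph $G'$ associated with this partition is $d$-rigid, and that for each $1\le i\le m$ the graph $Q_i$ is connected. Then $G$ is $d$-rigid.
   Context: The reduced graph is $G'=([m],E')$ with $\{i,j\}\in E'$ iff $G$ has an edge between $V_i$ and $V_j$. For $A,B\subseteq V$, $G[A,B]$ is the graph on $A\cup B$ whose edges are the edges $e$ of $G$ with $e\cap A\ne\varnothing$, $e\cap B\ne\varnothing$, $e\subseteq A\cup B$ (so $G[A,A]=G[A]$). $Q_i$ is the graph on $V_i$ whose edges are the pairs $\{u,v\}\subseteq V_i$ for which there exist $d$ distinct indices $j_1,\dots,j_d\in[m]$ such that $u$ and $v$ are connected by a path in $G[V_i,V_{j_k}]$ for every $k=1,\dots,d$. A $d$-dimensional framework $(G,\mathbf{p})$ is rigid if every continuous edge-length-preserving motion of the vertices starting at $\mathbf{p}$ preserves all pairwise distances; $\mathbf{p}$ is generic if its coordinates are algebraically independent over $\mathbb{Q}$; a graph is $d$-rigid if $(G,\mathbf{p})$ is rigid for some (equivalently, every) generic $\mathbf{p}:V\to\mathbb{R}^d$. *)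

theory Defs
  imports "HOL-Analysis.Analysis" "HOL-Library.Poly_Mapping" "HOL-Library.Disjoint_Sets"
begin

section \<open>Finite simple graphs\<close>

type_synonym 'a graph = "'a set \<times> 'a set set"

abbreviation verts :: "'a graph \<Rightarrow> 'a set" where
  "verts \<equiv> fst"

abbreviation edges :: "'a graph \<Rightarrow> 'a set set" where
  "edges \<equiv> snd"

definition finite_graph :: "'a graph \<Rightarrow> bool" where
  "finite_graph G \<longleftrightarrow> finite (verts G) \<and> (\<forall>e\<in>edges G. e \<subseteq> verts G \<and> card e = 2)"

definition path_between :: "'a graph \<Rightarrow> 'a \<Rightarrow> 'a list \<Rightarrow> 'a \<Rightarrow> bool" where
  "path_between G u xs v \<longleftrightarrow>
     xs \<noteq> [] \<and> hd xs = u \<and> last xs = v \<and> distinct xs \<and> set xs \<subseteq> verts G \<and>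
     successively (\<lambda>x y. {x, y} \<in> edges G) xs"

definition linked :: "'a graph \<Rightarrow> 'a \<Rightarrow> 'a \<Rightarrow> bool" where
  "linked G u v \<longleftrightarrow> (\<exists>xs. path_between G u xs v)"

definition connected_graph :: "'a graph \<Rightarrow> bool" where
  "connected_graph G \<longleftrightarrow> verts G \<noteq> {} \<and> (\<forall>u\<in>verts G. \<forall>v\<in>verts G. linked G u v)"

text \<open>The graph $G[A,B]$; the sets $A$ and $B$ need not be disjoint.\<close>

definition between :: "'a graph \<Rightarrow> 'a set \<Rightarrow> 'a set \<Rightarrow> 'a graph" where
  "between G A B =
     (A \<union> B, {e \<in> edges G. e \<inter> A \<noteq> {} \<and> e \<inter> B \<noteq> {} \<and> e \<subseteq> A \<union> B})"

section \<open>The reduced graph and the graphs $Q_i$ of an indexed partition\<close>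

definition reduced_graph :: "'a graph \<Rightarrow> nat \<Rightarrow> (nat \<Rightarrow> 'a set) \<Rightarrow> nat graph" where
  "reduced_graph G m P =
     ({1..m},
      {{i, j} | i j. i \<in> {1..m} \<and> j \<in> {1..m} \<and> i \<noteq> j \<and>
                     (\<exists>u\<in>P i. \<exists>v\<in>P j. {u, v} \<in> edges G)})"

text \<open>The index \<open>j = i\<close> is allowed in \<open>J\<close>.\<close>

definition Q_graph :: "nat \<Rightarrow> 'a graph \<Rightarrow> nat \<Rightarrow> (nat \<Rightarrow> 'a set) \<Rightarrow> nat \<Rightarrow> 'a graph" where
  "Q_graph d G m P i =
     (P i,
      {{u, v} | u v. u \<in> P i \<and> v \<in> P i \<and> u \<noteq> v \<and>
                     (\<exists>J\<subseteq>{1..m}. card J = d \<and> (\<forall>j\<in>J. linked (between G (P i) (P j)) u v))})"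

section \<open>Algebraic independence over the rationals\<close>

text \<open>
  A polynomial over the rationals with variables in \<open>'i\<close> is a finitely supported map from
  monomials to coefficients, and a monomial is a finitely supported map from variables to
  exponents.
\<close>

type_synonym 'i rat_mpoly = "('i \<Rightarrow>\<^sub>0 nat) \<Rightarrow>\<^sub>0 rat"

definition mpoly_vars :: "'i rat_mpoly \<Rightarrow> 'i set" where
  "mpoly_vars f = (\<Union>\<mu>\<in>Poly_Mapping.keys f. Poly_Mapping.keys \<mu>)"

definition mpoly_eval :: "('i \<Rightarrow> real) \<Rightarrow> 'i rat_mpoly \<Rightarrow> real" where
  "mpoly_eval x f =
     (\<Sum>\<mu>\<in>Poly_Mapping.keys f.
        of_rat (Poly_Mapping.lookup f \<mu>) *
        (\<Prod>i\<in>Poly_Mapping.keys \<mu>. x i ^ Poly_Mapping.lookup \<mu> i))"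

definition algebraically_independent :: "'i set \<Rightarrow> ('i \<Rightarrow> real) \<Rightarrow> bool" where
  "algebraically_independent I x \<longleftrightarrow>
     (\<forall>f. mpoly_vars f \<subseteq> I \<longrightarrow> mpoly_eval x f = 0 \<longrightarrow> f = 0)"

section \<open>Rigidity\<close>

text \<open>
  Only the values of a placement \<open>p\<close> on the vertex set are relevant. The ambient space is
  \<open>real ^ 'n\<close>, of dimension \<open>CARD('n)\<close>.
\<close>

definition generic :: "'a set \<Rightarrow> ('a \<Rightarrow> real ^ 'n) \<Rightarrow> bool" where
  "generic V p \<longleftrightarrow> algebraically_independent (V \<times> (UNIV :: 'n set)) (\<lambda>(v, k). p v $ k)"

definition motion :: "'a graph \<Rightarrow> ('a \<Rightarrow> real ^ 'n) \<Rightarrow> (real \<Rightarrow> 'a \<Rightarrow> real ^ 'n) \<Rightarrow> bool" where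
  "motion G p q \<longleftrightarrow>
     (\<forall>v\<in>verts G. continuous_on {0..1} (\<lambda>t. q t v) \<and> q 0 v = p v) \<and>
     (\<forall>t\<in>{0..1}. \<forall>u v. {u, v} \<in> edges G \<longrightarrow> dist (q t u) (q t v) = dist (p u) (p v))"

definition rigid_framework :: "'a graph \<Rightarrow> ('a \<Rightarrow> real ^ 'n) \<Rightarrow> bool" where
  "rigid_framework G p \<longleftrightarrow>
     (\<forall>q. motion G p q \<longrightarrow>
        (\<forall>t\<in>{0..1}. \<forall>u\<in>verts G. \<forall>v\<in>verts G. dist (q t u) (q t v) = dist (p u) (p v)))"

text \<open>\<open>d_rigid TYPE('n) G\<close> is $d$-rigidity for $d$ = \<open>CARD('n)\<close>.\<close>

definition d_rigid :: "'n::finite itself \<Rightarrow> 'a graph \<Rightarrow> bool" where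
  "d_rigid (_ :: 'n itself) G \<longleftrightarrow>
     (\<exists>p :: 'a \<Rightarrow> real ^ 'n. generic (verts G) p \<and> rigid_framework G p)"

end

theory Submission
  imports Defs
begin

text \<open>
  Collapse every part \<open>V\<^sub>i\<close> to the point \<open>p\<^sub>i\<close> of a generic rigid framework of the reduced graph, and
  let the edges inside the parts have a fixed generic direction \<open>y\<close>. An infinitesimal motion of
  this degenerate framework is constant on each part, because a \<open>Q\<^sub>i\<close>-edge \<open>uv\<close> makes \<open>f u - f v\<close>
  orthogonal to \<open>d\<close> independent vectors. It therefore descends to the reduced graph and is trivial.
  The degenerate framework is the limit of frameworks in which the vertices of \<open>V\<^sub>i\<close> are spread
  along \<open>y\<close> near \<open>p\<^sub>i\<close>. By compactness, generic frameworks close to these are infinitesimally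
  rigid, hence rigid.

  Both passages between rigidity and infinitesimal rigidity use averaging: \<open>p\<close> and \<open>q\<close> give an edge
  the same length iff \<open>q - p\<close> is infinitesimally length-preserving on that edge at \<open>(p + q) / 2\<close>.
\<close>

section \<open>Rational polynomial functions and algebraic independence\<close>

text \<open>Collapsing a part gives its inner edges length zero, so in the limit they would impose
  no condition. But the condition \<open>(p u - p v) \<bullet> (f u - f v) = 0\<close> depends only
  on the line spanned by the edge vector. The limit framework therefore prescribes directions
  separately from positions, and compactness is run with rescaled edge vectors. A common direction
  \<open>y\<close> for all inner edges makes \<open>y \<bullet> f\<close> constant along paths in
  \<open>G[V_i,V_i]\<close>, just as \<open>(p_i - p_j) \<bullet> f\<close> is constant along paths
  in \<open>G[V_i,V_j]\<close>. If \<open>i\<close> belongs to \<open>J\<close>, only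
  \<open>d - 1\<close> differences are available and \<open>y\<close> is the missing direction; it
  must not be parallel to the affine hyperplane through the \<open>p_j\<close> with \<open>j\<close>
  in \<open>J\<close>. Finitely many sets \<open>J\<close> exclude finitely many hyperplanes for
  \<open>y\<close>. A motion is only assumed continuous, so it need not have a velocity. Averaging
  is an exact identity between finite displacements and takes the place of differentiating the
  squared lengths.\<close>

definition monomial_eval :: "('i \<Rightarrow> real) \<Rightarrow> ('i \<Rightarrow>\<^sub>0 nat) \<Rightarrow> real" where
  "monomial_eval x \<mu> = (\<Prod>i\<in>Poly_Mapping.keys \<mu>. x i ^ Poly_Mapping.lookup \<mu> i)"

lemma monomial_eval_superset:
  assumes "finite S" "Poly_Mapping.keys \<mu> \<subseteq> S"
  shows "monomial_eval x \<mu> = (\<Prod>i\<in>S. x i ^ Poly_Mapping.lookup \<mu> i)"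
  unfolding monomial_eval_def
  by (rule prod.mono_neutral_left) (use assms in \<open>auto simp: in_keys_iff\<close>)

lemma monomial_eval_add: "monomial_eval x (\<mu> + \<nu>) = monomial_eval x \<mu> * monomial_eval x \<nu>"
proof -
  let ?S = "Poly_Mapping.keys \<mu> \<union> Poly_Mapping.keys \<nu>"
  have "Poly_Mapping.keys (\<mu> + \<nu>) \<subseteq> ?S"
    by (rule Poly_Mapping.keys_add)
  then show ?thesis
    by (simp add: monomial_eval_superset[of ?S] lookup_add power_add prod.distrib)
qed

lemma mpoly_eval_superset:
  assumes "finite S" "Poly_Mapping.keys f \<subseteq> S"
  shows "mpoly_eval x f = (\<Sum>\<mu>\<in>S. of_rat (Poly_Mapping.lookup f \<mu>) * monomial_eval x \<mu>)"
  unfolding mpoly_eval_def monomial_eval_def[symmetric]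
  by (rule sum.mono_neutral_left) (use assms in \<open>auto simp: in_keys_iff\<close>)

lemma mpoly_eval_zero [simp]: "mpoly_eval x 0 = 0"
  by (simp add: mpoly_eval_def)

lemma mpoly_eval_add: "mpoly_eval x (f + g) = mpoly_eval x f + mpoly_eval x g"
proof -
  let ?S = "Poly_Mapping.keys f \<union> Poly_Mapping.keys g"
  have "Poly_Mapping.keys (f + g) \<subseteq> ?S"
    by (rule Poly_Mapping.keys_add)
  then show ?thesis
    by (simp add: mpoly_eval_superset[of ?S] lookup_add of_rat_add distrib_right sum.distrib)
qed

lemma mpoly_eval_sum: "mpoly_eval x (\<Sum>a\<in>A. F a) = (\<Sum>a\<in>A. mpoly_eval x (F a))"
  by (induction A rule: infinite_finite_induct) (simp_all add: mpoly_eval_add)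

lemma mpoly_eval_single:
  "mpoly_eval x (Poly_Mapping.single \<mu> c) = of_rat c * monomial_eval x \<mu>"
  by (subst mpoly_eval_superset[of "{\<mu>}"]) auto

lemma mpoly_eval_mult: "mpoly_eval x (f * g) = mpoly_eval x f * mpoly_eval x g"
proof -
  let ?s = "\<lambda>f \<mu>. Poly_Mapping.single \<mu> (Poly_Mapping.lookup f \<mu>)"
  have "h = (\<Sum>\<mu>\<in>Poly_Mapping.keys h. ?s h \<mu>)" for h :: "'a rat_mpoly"
    by (rule poly_mapping_eqI) (auto simp: lookup_sum lookup_single when_def in_keys_iff)
  then have "f * g = (\<Sum>\<mu>\<in>Poly_Mapping.keys f. ?s f \<mu>) * (\<Sum>\<nu>\<in>Poly_Mapping.keys g. ?s g \<nu>)"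
    by metis
  also have "\<dots> = (\<Sum>\<mu>\<in>Poly_Mapping.keys f. \<Sum>\<nu>\<in>Poly_Mapping.keys g.
      Poly_Mapping.single (\<mu> + \<nu>) (Poly_Mapping.lookup f \<mu> * Poly_Mapping.lookup g \<nu>))"
    by (simp add: sum_product mult_single)
  finally have "mpoly_eval x (f * g) = (\<Sum>\<mu>\<in>Poly_Mapping.keys f. \<Sum>\<nu>\<in>Poly_Mapping.keys g.
      (of_rat (Poly_Mapping.lookup f \<mu>) * monomial_eval x \<mu>) *
      (of_rat (Poly_Mapping.lookup g \<nu>) * monomial_eval x \<nu>))"
    by (simp add: mpoly_eval_sum mpoly_eval_single monomial_eval_add of_rat_mult mult_ac)
  then show ?thesis
    unfolding sum_product[symmetric]
    by (simp add: mpoly_eval_superset[OF finite_keys subset_refl])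
qed

lemma mpoly_vars_add: "mpoly_vars (f + g) \<subseteq> mpoly_vars f \<union> mpoly_vars g"
  unfolding mpoly_vars_def using Poly_Mapping.keys_add[of f g] by blast

lemma mpoly_vars_mult: "mpoly_vars (f * g) \<subseteq> mpoly_vars f \<union> mpoly_vars g"
proof
  fix i assume "i \<in> mpoly_vars (f * g)"
  then obtain \<mu> where \<mu>: "\<mu> \<in> Poly_Mapping.keys (f * g)" "i \<in> Poly_Mapping.keys \<mu>"
    by (auto simp: mpoly_vars_def)
  then obtain a b where "a \<in> Poly_Mapping.keys f" "b \<in> Poly_Mapping.keys g" "\<mu> = a + b"
    using keys_mult[of f g] by blast
  then show "i \<in> mpoly_vars f \<union> mpoly_vars g"
    using \<mu>(2) Poly_Mapping.keys_add[of a b] by (auto simp: mpoly_vars_def)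
qed

text \<open>Once sums and products are covered, monomials stay out of sight: later arguments use
  only that such a function is continuous and that, its coefficients being rational, a zero at an
  independent point makes it vanish identically.\<close>

definition polyfun :: "'i set \<Rightarrow> (('i \<Rightarrow> real) \<Rightarrow> real) \<Rightarrow> bool" where
  "polyfun I F \<longleftrightarrow> (\<exists>f. mpoly_vars f \<subseteq> I \<and> F = (\<lambda>x. mpoly_eval x f))"

lemma polyfun_const: "polyfun I (\<lambda>x. of_rat c)"
  unfolding polyfun_def
  by (rule exI[of _ "Poly_Mapping.single 0 c"])
    (auto simp: mpoly_eval_single monomial_eval_def mpoly_vars_def split: if_splits)

lemma polyfun_var:
  assumes "i \<in> I"
  shows "polyfun I (\<lambda>x. x i)"
  unfolding polyfun_def
  by (rule exI[of _ "Poly_Mapping.single (Poly_Mapping.single i 1) 1"])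
    (use assms in \<open>auto simp: mpoly_eval_single monomial_eval_def mpoly_vars_def\<close>)

lemma polyfun_add: "polyfun I F \<Longrightarrow> polyfun I G \<Longrightarrow> polyfun I (\<lambda>x. F x + G x)"
  unfolding polyfun_def
proof (elim exE conjE)
  fix f g assume "mpoly_vars f \<subseteq> I" "F = (\<lambda>x. mpoly_eval x f)" "mpoly_vars g \<subseteq> I" "G = (\<lambda>x. mpoly_eval x g)"
  then show "\<exists>h. mpoly_vars h \<subseteq> I \<and> (\<lambda>x. F x + G x) = (\<lambda>x. mpoly_eval x h)"
    using mpoly_vars_add[of f g] by (intro exI[of _ "f + g"]) (auto simp: mpoly_eval_add)
qed

lemma polyfun_mult: "polyfun I F \<Longrightarrow> polyfun I G \<Longrightarrow> polyfun I (\<lambda>x. F x * G x)"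
  unfolding polyfun_def
proof (elim exE conjE)
  fix f g assume "mpoly_vars f \<subseteq> I" "F = (\<lambda>x. mpoly_eval x f)" "mpoly_vars g \<subseteq> I" "G = (\<lambda>x. mpoly_eval x g)"
  then show "\<exists>h. mpoly_vars h \<subseteq> I \<and> (\<lambda>x. F x * G x) = (\<lambda>x. mpoly_eval x h)"
    using mpoly_vars_mult[of f g] by (intro exI[of _ "f * g"]) (auto simp: mpoly_eval_mult)
qed

lemma polyfun_diff:
  assumes "polyfun I F" "polyfun I G"
  shows "polyfun I (\<lambda>x. F x - G x)"
  using polyfun_add[OF assms(1) polyfun_mult[OF polyfun_const[of I "-1"] assms(2)]]
  by (simp add: of_rat_minus)

lemma polyfun_tendsto:
  assumes "polyfun I F" "\<And>i. i \<in> I \<Longrightarrow> ((\<lambda>t. x t i) \<longlongrightarrow> y i) net"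
  shows "((\<lambda>t. F (x t)) \<longlongrightarrow> F y) net"
proof -
  obtain f where f: "mpoly_vars f \<subseteq> I" "F = (\<lambda>x. mpoly_eval x f)"
    using assms(1) by (auto simp: polyfun_def)
  then have "i \<in> I" if "\<mu> \<in> Poly_Mapping.keys f" "i \<in> Poly_Mapping.keys \<mu>" for \<mu> i
    using that by (auto simp: mpoly_vars_def)
  then show ?thesis
    unfolding f mpoly_eval_def by (intro tendsto_intros assms(2))
qed

lemma polyfun_independent_zero:
  assumes "algebraically_independent I x" "polyfun I F" "F x = 0"
  shows "F z = 0"
  using assms by (auto simp: polyfun_def algebraically_independent_def)

section \<open>Existence of algebraically independent points near any point\<close>

lemma countable_poly_mapping_keys_subset:
  assumes "countable M"
  shows "countable {f :: 'a \<Rightarrow>\<^sub>0 'b::{zero,countable}. Poly_Mapping.keys f \<subseteq> M}"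
proof -
  have "countable {f :: 'a \<Rightarrow>\<^sub>0 'b. Poly_Mapping.keys f \<subseteq> K}" if "finite K" for K
  proof (rule countable_image_inj_on)
    show "countable ((\<lambda>f. restrict (Poly_Mapping.lookup f) K) `
        {f :: 'a \<Rightarrow>\<^sub>0 'b. Poly_Mapping.keys f \<subseteq> K})"
      by (rule countable_subset[of _ "K \<rightarrow>\<^sub>E UNIV"]) (use that in \<open>auto intro!: countable_PiE\<close>)
    show "inj_on (\<lambda>f. restrict (Poly_Mapping.lookup f) K)
        {f :: 'a \<Rightarrow>\<^sub>0 'b. Poly_Mapping.keys f \<subseteq> K}"
    proof (rule inj_onI, rule poly_mapping_eqI)
      fix f g :: "'a \<Rightarrow>\<^sub>0 'b" and k
      assume *: "f \<in> {f. Poly_Mapping.keys f \<subseteq> K}" "g \<in> {f. Poly_Mapping.keys f \<subseteq> K}"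
        "restrict (Poly_Mapping.lookup f) K = restrict (Poly_Mapping.lookup g) K"
      show "Poly_Mapping.lookup f k = Poly_Mapping.lookup g k"
      proof (cases "k \<in> K")
        case True
        then show ?thesis using fun_cong[OF *(3), of k] by simp
      next
        case False
        then have "k \<notin> Poly_Mapping.keys f" "k \<notin> Poly_Mapping.keys g" using * by auto
        then show ?thesis by (simp add: in_keys_iff)
      qed
    qed
  qed
  then have "countable (\<Union>K\<in>{K. finite K \<and> K \<subseteq> M}. {f :: 'a \<Rightarrow>\<^sub>0 'b. Poly_Mapping.keys f \<subseteq> K})"
    using countable_Collect_finite_subset[OF assms] by (intro countable_UN) (auto simp: conj_commute)
  moreover have "{f :: 'a \<Rightarrow>\<^sub>0 'b. Poly_Mapping.keys f \<subseteq> M} \<subseteq>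
      (\<Union>K\<in>{K. finite K \<and> K \<subseteq> M}. {f. Poly_Mapping.keys f \<subseteq> K})"
    by (intro subsetI UN_I[of "Poly_Mapping.keys _"]) auto
  ultimately show ?thesis
    by (rule countable_subset[rotated])
qed

text \<open>The counting lemma is applied at two levels: to exponents, which gives countably many
  monomials, and then to coefficients indexed by these monomials.\<close>

lemma countable_rat_mpoly:
  assumes "countable I"
  shows "countable {f :: 'i rat_mpoly. mpoly_vars f \<subseteq> I}"
proof -
  have "{f :: 'i rat_mpoly. mpoly_vars f \<subseteq> I} =
      {f. Poly_Mapping.keys f \<subseteq> {\<mu>. Poly_Mapping.keys \<mu> \<subseteq> I}}"
    by (auto simp: mpoly_vars_def)
  then show ?thesis
    by (simp add: countable_poly_mapping_keys_subset assms)
qed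

text \<open>As a function of the new coordinate, a nonzero polynomial is a nonzero univariate
  polynomial: its coefficients are polynomials in the old coordinates.\<close>

lemma finite_roots_new_coordinate:
  assumes x: "algebraically_independent I x" and i: "i \<notin> I"
    and f: "mpoly_vars f \<subseteq> insert i I" "f \<noteq> 0"
  shows "finite {t. mpoly_eval (x(i := t)) f = 0}"
proof -
  define m where "m \<mu> = (\<Prod>j\<in>Poly_Mapping.keys \<mu> - {i}. x j ^ Poly_Mapping.lookup \<mu> j)" for \<mu>
  define P where "P = (\<Sum>\<mu>\<in>Poly_Mapping.keys f.
     monom (of_rat (Poly_Mapping.lookup f \<mu>) * m \<mu>) (Poly_Mapping.lookup \<mu> i))"
  have mon: "monomial_eval (x(i := t)) \<mu> = t ^ Poly_Mapping.lookup \<mu> i * m \<mu>" for t \<mu>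
    by (subst monomial_eval_superset[of "insert i (Poly_Mapping.keys \<mu>)"])
      (auto simp: m_def prod.insert_remove intro!: prod.cong)
  have eval: "mpoly_eval (x(i := t)) f = poly P t" for t
    unfolding P_def poly_sum poly_monom mpoly_eval_def monomial_eval_def[symmetric] mon
    by (simp add: mult_ac)
  obtain \<mu>0 where \<mu>0: "\<mu>0 \<in> Poly_Mapping.keys f"
    using f(2) by fastforce
  \<comment> \<open>Any monomial of \<open>f\<close> singles out a power of \<open>t\<close> that
    survives: \<open>g\<close> below is the coefficient of \<open>t ^ k\<close> as a polynomial in
    the old variables. The map \<open>r\<close> deletes the variable \<open>i\<close> and is
    injective on \<open>S\<close>, so nothing cancels at \<open>r \<mu>0\<close>.\<close>
  define k where "k = Poly_Mapping.lookup \<mu>0 i"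
  define r where "r \<mu> = Poly_Mapping.update i 0 \<mu>" for \<mu> :: "'a \<Rightarrow>\<^sub>0 nat"
  define S where "S = {\<mu>\<in>Poly_Mapping.keys f. Poly_Mapping.lookup \<mu> i = k}"
  define g where "g = (\<Sum>\<mu>\<in>S. Poly_Mapping.single (r \<mu>) (Poly_Mapping.lookup f \<mu>))"
  have [simp]: "finite S" by (simp add: S_def)
  have lookup_r: "Poly_Mapping.lookup (r \<mu>) j = (if j = i then 0 else Poly_Mapping.lookup \<mu> j)" for \<mu> j
    by (simp add: r_def lookup_update)
  have keys_r: "Poly_Mapping.keys (r \<mu>) = Poly_Mapping.keys \<mu> - {i}" for \<mu>
    by (auto simp: in_keys_iff lookup_r split: if_splits)
  have inj: "\<mu> = \<mu>'" if "\<mu> \<in> S" "\<mu>' \<in> S" "r \<mu> = r \<mu>'" for \<mu> \<mu>'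
  proof (rule poly_mapping_eqI)
    fix j
    show "Poly_Mapping.lookup \<mu> j = Poly_Mapping.lookup \<mu>' j"
      using that lookup_r[of \<mu> j] lookup_r[of \<mu>' j] by (cases "j = i") (auto simp: S_def)
  qed
  have "\<mu>0 \<in> S" using \<mu>0 by (simp add: S_def k_def)
  have "Poly_Mapping.lookup g (r \<mu>0) = (\<Sum>\<mu>\<in>S. if \<mu> = \<mu>0 then Poly_Mapping.lookup f \<mu> else 0)"
    unfolding g_def lookup_sum
    by (rule sum.cong) (use inj \<open>\<mu>0 \<in> S\<close> in \<open>auto simp: lookup_single when_def\<close>)
  also have "\<dots> = Poly_Mapping.lookup f \<mu>0" using \<open>\<mu>0 \<in> S\<close> by simp
  finally have "g \<noteq> 0" using \<mu>0 by (auto simp: in_keys_iff)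
  moreover have "mpoly_vars g \<subseteq> I"
  proof
    fix j assume "j \<in> mpoly_vars g"
    then obtain \<nu> where \<nu>: "\<nu> \<in> Poly_Mapping.keys g" "j \<in> Poly_Mapping.keys \<nu>"
      by (auto simp: mpoly_vars_def)
    have "Poly_Mapping.keys g \<subseteq> (\<Union>\<mu>\<in>S. Poly_Mapping.keys (Poly_Mapping.single (r \<mu>) (Poly_Mapping.lookup f \<mu>)))"
      unfolding g_def by (rule keys_sum)
    then obtain \<mu> where "\<mu> \<in> S" "\<nu> = r \<mu>" using \<nu> by (auto split: if_splits)
    then show "j \<in> I" using \<nu>(2) f(1) by (auto simp: keys_r S_def mpoly_vars_def)
  qed
  ultimately have "mpoly_eval x g \<noteq> 0"
    using x by (auto simp: algebraically_independent_def)
  also have "mpoly_eval x g = (\<Sum>\<mu>\<in>S. of_rat (Poly_Mapping.lookup f \<mu>) * m \<mu>)"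
    by (simp add: g_def mpoly_eval_sum mpoly_eval_single monomial_eval_def keys_r m_def lookup_r)
  also have "\<dots> = coeff P k"
    unfolding P_def coeff_sum coeff_monom S_def
    by (simp add: sum.inter_filter)
  finally have "P \<noteq> 0" by auto
  then show ?thesis
    unfolding eval by (rule poly_roots_finite)
qed

text \<open>One coordinate is chosen at a time. Each of the countably many nonzero polynomials
  forbids finitely many of its values, and an open interval is uncountable.\<close>

lemma algebraically_independent_dense:
  assumes "finite I" "\<eta> > 0"
  shows "\<exists>x. algebraically_independent I x \<and> (\<forall>i\<in>I. \<bar>x i - a i\<bar> < \<eta>)"
  using assms(1)
proof (induction I)
  case empty
  have "f = 0" if v: "mpoly_vars f \<subseteq> {}" and e: "mpoly_eval x f = 0" for f :: "'a rat_mpoly" and x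
  proof -
    have sub: "Poly_Mapping.keys f \<subseteq> {0}" using v by (auto simp: mpoly_vars_def)
    then have "mpoly_eval x f = of_rat (Poly_Mapping.lookup f 0)"
      by (subst mpoly_eval_superset[of "{0}"]) (auto simp: monomial_eval_def)
    then show ?thesis
      using sub e by (intro poly_mapping_eqI) (auto simp: in_keys_iff)
  qed
  then show ?case by (auto simp: algebraically_independent_def)
next
  case (insert i I)
  then obtain x where x: "algebraically_independent I x" "\<forall>j\<in>I. \<bar>x j - a j\<bar> < \<eta>" by auto
  define Z where "Z = (\<Union>f\<in>{f. mpoly_vars f \<subseteq> insert i I} - {0}. {t. mpoly_eval (x(i := t)) f = 0})"
  have "countable ({f. mpoly_vars f \<subseteq> insert i I} - {0})"
    using countable_rat_mpoly[of "insert i I"] insert.hyps by (simp add: countable_finite)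
  then have "countable Z"
    unfolding Z_def
    by (rule countable_UN)
      (use insert.hyps in \<open>auto intro!: countable_finite finite_roots_new_coordinate[OF x(1)]\<close>)
  moreover have "uncountable {a i - \<eta><..<a i + \<eta>}"
    using \<open>\<eta> > 0\<close> by (simp add: uncountable_open_interval)
  ultimately obtain t where t: "t \<in> {a i - \<eta><..<a i + \<eta>}" "t \<notin> Z"
    using countable_subset[of "{a i - \<eta><..<a i + \<eta>}" Z] by blast
  then have "algebraically_independent (insert i I) (x(i := t))"
    by (auto simp: algebraically_independent_def Z_def)
  moreover have "\<forall>j\<in>insert i I. \<bar>(x(i := t)) j - a j\<bar> < \<eta>"
    using x(2) t(1) insert.hyps by auto
  ultimately show ?case by blast
qed

text \<open>Fraction-free Gaussian elimination: a nonzero entry of one row eliminates that row from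
  the others.\<close>

lemma polyfun_rows_independent:
  fixes row :: "'j \<Rightarrow> 'k \<Rightarrow> ('i \<Rightarrow> real) \<Rightarrow> real"
  assumes "finite J" "\<And>j k. j \<in> J \<Longrightarrow> k \<in> K \<Longrightarrow> polyfun I (row j k)"
    and "\<And>c. (\<forall>k\<in>K. (\<Sum>j\<in>J. c j * row j k z0) = 0) \<Longrightarrow> \<forall>j\<in>J. c j = 0"
  shows "\<exists>D. polyfun I D \<and> D z0 \<noteq> 0 \<and>
    (\<forall>z. D z \<noteq> 0 \<longrightarrow> (\<forall>c. (\<forall>k\<in>K. (\<Sum>j\<in>J. c j * row j k z) = 0) \<longrightarrow> (\<forall>j\<in>J. c j = 0)))"
  using assms
proof (induction J arbitrary: row)
  case empty
  then show ?case using polyfun_const[of I 1] by auto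
next
  case (insert j0 J)
  note indep = insert.prems(2)
  have "\<exists>k\<in>K. row j0 k z0 \<noteq> 0"
  proof (rule ccontr)
    assume "\<not> ?thesis"
    then have "\<forall>k\<in>K. (\<Sum>j\<in>insert j0 J. of_bool (j = j0) * row j k z0) = 0"
      by (auto intro!: sum.neutral)
    from indep[OF this] show False by auto
  qed
  then obtain k0 where k0: "k0 \<in> K" "row j0 k0 z0 \<noteq> 0" by blast
  define row' where "row' j k z = row j0 k0 z * row j k z - row j k0 z * row j0 k z" for j k z
  have row'_sum: "(\<Sum>j\<in>J. c j * row' j k z) =
      row j0 k0 z * (\<Sum>j\<in>J. c j * row j k z) - (\<Sum>j\<in>J. c j * row j k0 z) * row j0 k z" for c k z
    by (simp add: row'_def sum_distrib_left sum_distrib_right algebra_simps sum_subtractf)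
  have "\<exists>D. polyfun I D \<and> D z0 \<noteq> 0 \<and>
    (\<forall>z. D z \<noteq> 0 \<longrightarrow> (\<forall>c. (\<forall>k\<in>K. (\<Sum>j\<in>J. c j * row' j k z) = 0) \<longrightarrow> (\<forall>j\<in>J. c j = 0)))"
  proof (rule insert.IH)
    show "polyfun I (row' j k)" if "j \<in> J" "k \<in> K" for j k
      unfolding row'_def using that insert.prems(1) k0(1)
      by (intro polyfun_diff polyfun_mult) auto
    fix c assume c: "\<forall>k\<in>K. (\<Sum>j\<in>J. c j * row' j k z0) = 0"
    \<comment> \<open>A dependency of the reduced rows lifts to the original ones: coefficients are
      multiplied by the pivot, and what the reduction subtracted is charged to
      \<open>j0\<close>.\<close>
    define c' where "c' j = (if j = j0 then - (\<Sum>j\<in>J. c j * row j k0 z0) else row j0 k0 z0 * c j)" for j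
    have "(\<Sum>j\<in>J. c' j * row j k z0) = row j0 k0 z0 * (\<Sum>j\<in>J. c j * row j k z0)" for k
      unfolding sum_distrib_left by (rule sum.cong) (use insert.hyps in \<open>auto simp: c'_def\<close>)
    then have "\<forall>k\<in>K. (\<Sum>j\<in>insert j0 J. c' j * row j k z0) = 0"
      using c insert.hyps by (simp add: row'_sum c'_def)
    from indep[OF this] show "\<forall>j\<in>J. c j = 0"
      using insert.hyps k0(2) by (auto simp: c'_def split: if_splits)
  qed
  then obtain D where D: "polyfun I D" "D z0 \<noteq> 0"
    "\<And>z c. D z \<noteq> 0 \<Longrightarrow> \<forall>k\<in>K. (\<Sum>j\<in>J. c j * row' j k z) = 0 \<Longrightarrow> \<forall>j\<in>J. c j = 0"
    by blast
  \<comment> \<open>The new witness is \<open>D\<close> times the current pivot, so overall a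
    product of pivots. It certifies independence where it is nonzero; nothing is claimed where it
    vanishes.\<close>
  have "\<forall>j\<in>insert j0 J. c j = 0"
    if z: "D z * row j0 k0 z \<noteq> 0" and c: "\<forall>k\<in>K. (\<Sum>j\<in>insert j0 J. c j * row j k z) = 0" for z c
  proof -
    have c': "(\<Sum>j\<in>J. c j * row j k z) = - c j0 * row j0 k z" if "k \<in> K" for k
      using c that insert.hyps by (simp add: add_eq_0_iff)
    have J: "\<forall>j\<in>J. c j = 0"
      by (rule D(3)) (use z in \<open>auto simp: row'_sum c' k0(1)\<close>)
    then have "c j0 * row j0 k0 z = 0" using c'[OF k0(1)] by simp
    then show ?thesis using J z by auto
  qed
  moreover have "polyfun I (\<lambda>z. D z * row j0 k0 z)"
    using D(1) insert.prems(1) k0(1) by (intro polyfun_mult) auto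
  ultimately show ?case using D(2) k0(2)
    by (intro exI[of _ "\<lambda>z. D z * row j0 k0 z"]) auto
qed

section \<open>Infinitesimal motions and degenerations\<close>

text \<open>Gram-Schmidt in the space of functions on \<open>V\<close> with inner product
  \<open>\<Sum>v\<in>V. f v \<bullet> g v\<close>. The family may be dependent, so the coefficients
  exist but need not be unique.\<close>

lemma orthogonal_projection_family:
  fixes t :: "'i \<Rightarrow> 'v \<Rightarrow> 'b::real_inner"
  assumes "finite I" "finite V"
  shows "\<exists>c. \<forall>j\<in>I. (\<Sum>v\<in>V. (f v - (\<Sum>i\<in>I. c i *\<^sub>R t i v)) \<bullet> t j v) = 0"
  using assms(1)
proof (induction I arbitrary: f)
  case (insert j0 I)
  obtain z where z: "\<And>j. j \<in> I \<Longrightarrow> (\<Sum>v\<in>V. (t j0 v - (\<Sum>i\<in>I. z i *\<^sub>R t i v)) \<bullet> t j v) = 0"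
    using insert.IH by blast
  obtain c where c: "\<And>j. j \<in> I \<Longrightarrow> (\<Sum>v\<in>V. (f v - (\<Sum>i\<in>I. c i *\<^sub>R t i v)) \<bullet> t j v) = 0"
    using insert.IH by blast
  define w where "w v = t j0 v - (\<Sum>i\<in>I. z i *\<^sub>R t i v)" for v
  define e where "e v = f v - (\<Sum>i\<in>I. c i *\<^sub>R t i v)" for v
  \<comment> \<open>The coefficient of \<open>e\<close> along \<open>w\<close>. If \<open>w\<close>
    vanishes on \<open>V\<close>, division by zero gives \<open>k = 0\<close>, which is harmless
    because \<open>w\<close> then contributes nothing.\<close>
  define k where "k = (\<Sum>v\<in>V. e v \<bullet> w v) / (\<Sum>v\<in>V. w v \<bullet> w v)"
  define c' where "c' i = (if i = j0 then k else c i - k * z i)" for i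
  have "(\<Sum>i\<in>I. c' i *\<^sub>R t i v) = (\<Sum>i\<in>I. c i *\<^sub>R t i v - k *\<^sub>R (z i *\<^sub>R t i v))" for v
    by (rule sum.cong) (use insert.hyps in \<open>auto simp: c'_def scaleR_diff_left\<close>)
  then have c': "f v - (\<Sum>i\<in>insert j0 I. c' i *\<^sub>R t i v) = e v - k *\<^sub>R w v" for v
    using insert.hyps
    by (simp add: e_def w_def c'_def sum_subtractf scaleR_sum_right scaleR_diff_right)
  have I: "(\<Sum>v\<in>V. (e v - k *\<^sub>R w v) \<bullet> t j v) = 0" if "j \<in> I" for j
    using z[OF that] c[OF that] unfolding e_def[symmetric] w_def[symmetric]
    by (simp add: inner_diff_left sum_subtractf sum_distrib_left[symmetric])
  have "(\<Sum>v\<in>V. (e v - k *\<^sub>R w v) \<bullet> (\<Sum>i\<in>I. z i *\<^sub>R t i v)) =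
      (\<Sum>i\<in>I. z i * (\<Sum>v\<in>V. (e v - k *\<^sub>R w v) \<bullet> t i v))"
    unfolding inner_sum_right sum_distrib_left by (subst sum.swap) simp
  also have "\<dots> = 0" using I by simp
  finally have "(\<Sum>v\<in>V. (e v - k *\<^sub>R w v) \<bullet> t j0 v) = (\<Sum>v\<in>V. (e v - k *\<^sub>R w v) \<bullet> w v)"
    by (simp add: w_def inner_diff_right sum_subtractf)
  also have "\<dots> = (\<Sum>v\<in>V. e v \<bullet> w v) - k * (\<Sum>v\<in>V. w v \<bullet> w v)"
    by (simp add: inner_diff_left sum_subtractf sum_distrib_left)
  also have "\<dots> = 0"
  proof (cases "(\<Sum>v\<in>V. w v \<bullet> w v) = 0")
    case True
    then have "\<forall>v\<in>V. w v = 0"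
      using assms(2) by (simp add: sum_nonneg_eq_0_iff)
    then show ?thesis by simp
  next
    case False
    then show ?thesis by (simp add: k_def)
  qed
  finally show ?case using I unfolding c'[symmetric] by (intro exI[of _ c']) auto
qed simp

text \<open>The residual of \<open>t j\<close> modulo the other members is orthogonal to them and
  has the same product with \<open>t j\<close> as with itself. Independence makes it nonzero, so it
  can be scaled into the dual of \<open>t j\<close>.\<close>

lemma dual_family:
  fixes t :: "'i \<Rightarrow> 'v \<Rightarrow> 'b::real_inner"
  assumes "finite I" "finite V"
    and indep: "\<And>c. \<forall>v\<in>V. (\<Sum>i\<in>I. c i *\<^sub>R t i v) = 0 \<Longrightarrow> \<forall>i\<in>I. c i = 0"
  shows "\<exists>s. \<forall>i\<in>I. \<forall>j\<in>I. (\<Sum>v\<in>V. t i v \<bullet> s j v) = of_bool (i = j)"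
proof -
  have "\<exists>s. \<forall>i\<in>I. (\<Sum>v\<in>V. t i v \<bullet> s v) = of_bool (i = j)" if j: "j \<in> I" for j
  proof -
    have "finite (I - {j})" using assms by simp
    from orthogonal_projection_family[OF this assms(2)]
    obtain c where c: "\<And>i. i \<in> I - {j} \<Longrightarrow>
        (\<Sum>v\<in>V. (t j v - (\<Sum>i\<in>I - {j}. c i *\<^sub>R t i v)) \<bullet> t i v) = 0" by blast
    define r where "r v = t j v - (\<Sum>i\<in>I - {j}. c i *\<^sub>R t i v)" for v
    have r: "(\<Sum>v\<in>V. r v \<bullet> t i v) = 0" if "i \<in> I" "i \<noteq> j" for i
      using c[of i] that by (simp add: r_def)
    have "(\<Sum>v\<in>V. r v \<bullet> (\<Sum>i\<in>I - {j}. c i *\<^sub>R t i v)) = (\<Sum>i\<in>I - {j}. c i * (\<Sum>v\<in>V. r v \<bullet> t i v))"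
      unfolding inner_sum_right sum_distrib_left by (subst sum.swap) simp
    also have "\<dots> = 0" using r by (intro sum.neutral) auto
    finally have rr: "(\<Sum>v\<in>V. r v \<bullet> t j v) = (\<Sum>v\<in>V. r v \<bullet> r v)"
      by (simp add: r_def inner_diff_right sum_subtractf)
    have "(\<Sum>v\<in>V. r v \<bullet> r v) \<noteq> 0"
    proof
      assume "(\<Sum>v\<in>V. r v \<bullet> r v) = 0"
      then have r0: "\<forall>v\<in>V. r v = 0" using assms(2) by (simp add: sum_nonneg_eq_0_iff)
      define c' where "c' i = (if i = j then 1 else - c i)" for i
      have "(\<Sum>i\<in>I. c' i *\<^sub>R t i v) = r v" for v
      proof -
        have "(\<Sum>i\<in>I - {j}. c' i *\<^sub>R t i v) = (\<Sum>i\<in>I - {j}. - (c i *\<^sub>R t i v))"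
          by (rule sum.cong) (auto simp: c'_def)
        then show ?thesis
          using assms(1) j by (simp add: sum.remove[of I j] r_def c'_def sum_negf)
      qed
      then have "\<forall>i\<in>I. c' i = 0" using r0 by (intro indep) simp
      then show False using j by (auto simp: c'_def)
    qed
    then show ?thesis
      using r rr by (intro exI[of _ "\<lambda>v. r v /\<^sub>R (\<Sum>v\<in>V. r v \<bullet> r v)"])
        (auto simp: inner_commute[of "t _ _"] sum_distrib_left[symmetric])
  qed
  then show ?thesis by metis
qed

lemma independent_family_orthogonal:
  fixes r :: "'i \<Rightarrow> 'b::euclidean_space"
  assumes "finite I" "card I = DIM('b)"
    and indep: "\<And>c. (\<Sum>i\<in>I. c i *\<^sub>R r i) = 0 \<Longrightarrow> \<forall>i\<in>I. c i = 0"
    and h: "\<And>i. i \<in> I \<Longrightarrow> h \<bullet> r i = 0"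
  shows "h = 0"
proof -
  have inj: "inj_on r I"
  proof (rule inj_onI, rule ccontr)
    fix i j assume *: "i \<in> I" "j \<in> I" "r i = r j" "i \<noteq> j"
    have "(\<Sum>a\<in>I. (of_bool (a = i) - of_bool (a = j)) *\<^sub>R r a) =
        (\<Sum>a\<in>I. if a = i then r a else 0) - (\<Sum>a\<in>I. if a = j then r a else 0)"
      unfolding sum_subtractf[symmetric] by (rule sum.cong) auto
    also have "\<dots> = 0" using * assms(1) by simp
    finally show False using indep[of "\<lambda>a. of_bool (a = i) - of_bool (a = j)"] * by auto
  qed
  have "independent (r ` I)"
  proof (rule independent_if_scalars_zero)
    fix c x assume *: "(\<Sum>x\<in>r ` I. c x *\<^sub>R x) = 0" "x \<in> r ` I"
    then have "(\<Sum>i\<in>I. c (r i) *\<^sub>R r i) = 0" by (simp add: sum.reindex[OF inj])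
    from indep[OF this] show "c x = 0" using *(2) by auto
  qed (use assms in simp)
  then have "UNIV \<subseteq> span (r ` I)"
    by (intro card_ge_dim_independent) (use assms card_image[OF inj] in auto)
  then have "h \<in> span (r ` I)" by auto
  then have "h \<bullet> h = 0"
    using orthogonal_to_span[of h "r ` I" h] h by (auto simp: orthogonal_def)
  then show ?thesis by simp
qed

lemma finite_family_convergent_subsequence:
  fixes h :: "nat \<Rightarrow> 'v \<Rightarrow> 'b::euclidean_space"
  assumes "finite V" "\<And>v. v \<in> V \<Longrightarrow> bounded (range (\<lambda>n. h n v))"
  shows "\<exists>r l. strict_mono r \<and> (\<forall>v\<in>V. (\<lambda>n. h (r n) v) \<longlonglongrightarrow> l v)"
  using assms
proof (induction V)
  case empty
  then show ?case using strict_mono_id by auto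
next
  case (insert v V)
  then obtain r l where r: "strict_mono r" "\<forall>v\<in>V. (\<lambda>n. h (r n) v) \<longlonglongrightarrow> l v" by auto
  have "bounded (range (\<lambda>n. h (r n) v))"
    by (rule bounded_subset[OF insert.prems[of v]]) auto
  then obtain x r' where r': "strict_mono r'" "((\<lambda>n. h (r n) v) \<circ> r') \<longlonglongrightarrow> x"
    using bounded_imp_convergent_subsequence by blast
  have "(\<lambda>n. h (r (r' n)) w) \<longlonglongrightarrow> (l(v := x)) w" if "w \<in> insert v V" for w
    using that r' insert.hyps LIMSEQ_subseq_LIMSEQ[OF _ r'(1), of "\<lambda>n. h (r n) w" "l w"] r(2)
    by (auto simp: o_def)
  moreover have "strict_mono (r \<circ> r')" using r(1) r'(1) by (rule strict_mono_o)
  ultimately show ?case by (intro exI[of _ "r \<circ> r'"] exI[of _ "l(v := x)"]) (auto simp: o_def)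
qed

section \<open>Infinitesimal motions and the trivial ones among them\<close>

definition infinitesimal_motion :: "'a graph \<Rightarrow> ('a \<Rightarrow> real ^ 'n) \<Rightarrow> ('a \<Rightarrow> real ^ 'n) \<Rightarrow> bool" where
  "infinitesimal_motion G p f \<longleftrightarrow> (\<forall>u v. {u, v} \<in> edges G \<longrightarrow> (p u - p v) \<bullet> (f u - f v) = 0)"

text \<open>Equivalent to \<open>transpose M = - M\<close>. The quadratic form is the shape in which
  it is used: \<open>M *v (p u - p v)\<close> is orthogonal to \<open>p u - p v\<close>.\<close>

definition skew :: "real ^ 'n ^ 'n \<Rightarrow> bool" where
  "skew M \<longleftrightarrow> (\<forall>x. (M *v x) \<bullet> x = 0)"

definition trivial_motion :: "'a set \<Rightarrow> ('a \<Rightarrow> real ^ 'n) \<Rightarrow> ('a \<Rightarrow> real ^ 'n) \<Rightarrow> bool" where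
  "trivial_motion V p f \<longleftrightarrow> (\<exists>M b. skew M \<and> (\<forall>v\<in>V. f v = M *v p v + b))"

lemma scaleR_matrix_vector_mult: "(c *\<^sub>R M) *v x = c *\<^sub>R (M *v (x :: real ^ 'n))"
  by (simp only: scaleR_matrix_vector_assoc)

text \<open>A normalised sequence of nontrivial motions may well converge to a trivial one.
  Representing \<open>f\<close> modulo trivial motions by a \<open>g\<close> orthogonal to all of
  them rules this out, because orthogonality passes to the limit.\<close>

lemma project_off_trivial:
  fixes q f :: "'v \<Rightarrow> real ^ 'n"
  assumes "finite V"
  shows "\<exists>g. trivial_motion V q (\<lambda>v. f v - g v) \<and>
    (\<forall>M b. skew M \<longrightarrow> (\<Sum>v\<in>V. g v \<bullet> (M *v q v + b)) = 0)"
proof -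
  \<comment> \<open>Different pairs \<open>(M, b)\<close> may give the same motion on
    \<open>V\<close>, so the images of a basis of \<open>S\<close> can be dependent; the projection
    lemma allows for this.\<close>
  define S :: "((real ^ 'n ^ 'n) \<times> (real ^ 'n)) set" where "S = {x. skew (fst x)}"
  have S: "subspace S"
    unfolding S_def subspace_def skew_def
    by (simp add: matrix_vector_mult_add_rdistrib inner_add_left scaleR_matrix_vector_mult
        del: scaleR_matrix_vector_assoc)
  obtain B where B: "B \<subseteq> S" "independent B" "S \<subseteq> span B"
    by (rule basis_exists)
  have "finite B" using B(2) by (rule independent_imp_finite)
  define L where "L x v = fst x *v q v + snd x" for x :: "(real ^ 'n ^ 'n) \<times> (real ^ 'n)" and v
  have L_add: "L (x + y) v = L x v + L y v" for x y v
    by (simp add: L_def matrix_vector_mult_add_rdistrib)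
  have L_scale: "L (c *\<^sub>R x) v = c *\<^sub>R L x v" for c x v
    by (simp add: L_def scaleR_matrix_vector_mult scaleR_add_right)
  have L_sum: "L (\<Sum>x\<in>A. c x *\<^sub>R x) v = (\<Sum>x\<in>A. c x *\<^sub>R L x v)" for A c v
    by (induction A rule: infinite_finite_induct) (simp_all add: L_add L_scale, simp_all add: L_def)
  obtain c where c: "\<And>x. x \<in> B \<Longrightarrow> (\<Sum>v\<in>V. (f v - (\<Sum>y\<in>B. c y *\<^sub>R L y v)) \<bullet> L x v) = 0"
    using orthogonal_projection_family[OF \<open>finite B\<close> assms] by blast
  define X where "X = (\<Sum>x\<in>B. c x *\<^sub>R x)"
  have "X \<in> S"
    unfolding X_def using B(1) by (intro subspace_sum[OF S] subspace_scale[OF S]) auto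
  define g where "g v = f v - L X v" for v
  have g: "(\<Sum>v\<in>V. g v \<bullet> L x v) = 0" if "x \<in> span B" for x
    using that
  proof (induction rule: span_induct_alt)
    case base
    then show ?case by (simp add: L_def)
  next
    case (step a x y)
    then show ?case
      using c[of x] by (simp add: L_add L_scale inner_add_right sum.distrib
          sum_distrib_left[symmetric] g_def X_def L_sum)
  qed
  have "(\<Sum>v\<in>V. g v \<bullet> (M *v q v + b)) = 0" if "skew M" for M b
    using g[of "(M, b)"] subsetD[OF B(3), of "(M, b)"] that by (simp add: S_def L_def)
  moreover have "trivial_motion V q (\<lambda>v. f v - g v)"
    unfolding trivial_motion_def using \<open>X \<in> S\<close>
    by (intro exI[of _ "fst X"] exI[of _ "snd X"]) (auto simp: S_def g_def L_def)
  ultimately show ?thesis by blast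
qed

definition graph_on_verts :: "'a graph \<Rightarrow> bool" where
  "graph_on_verts G \<longleftrightarrow> finite (verts G) \<and> (\<forall>u v. {u, v} \<in> edges G \<longrightarrow> u \<in> verts G \<and> v \<in> verts G)"

lemma trivial_motion_infinitesimal:
  assumes "graph_on_verts G" "trivial_motion (verts G) p f"
  shows "infinitesimal_motion G p f"
proof -
  obtain M b where *: "skew M" "\<And>v. v \<in> verts G \<Longrightarrow> f v = M *v p v + b"
    using assms(2) by (auto simp: trivial_motion_def)
  have "(p u - p v) \<bullet> (f u - f v) = 0" if "{u, v} \<in> edges G" for u v
  proof -
    have "u \<in> verts G" "v \<in> verts G" using that assms(1) by (auto simp: graph_on_verts_def)
    then have "f u - f v = M *v (p u - p v)"
      using *(2) by (simp add: matrix_vector_mult_diff_distrib)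
    then show ?thesis using *(1) by (simp add: skew_def inner_commute)
  qed
  then show ?thesis by (simp add: infinitesimal_motion_def)
qed

text \<open>Compactness: a sequence of nontrivial infinitesimal motions, made orthogonal to the trivial
  ones and normalised, would converge to a nontrivial motion of the limit data. In the limit the
  vertices may collide, so the edge directions \<open>D\<close> are limits of rescaled edge vectors.\<close>

lemma trivial_motions_nearby:
  fixes P0 :: "'a \<Rightarrow> real ^ 'n" and D :: "'a \<Rightarrow> 'a \<Rightarrow> real ^ 'n"
  assumes G: "graph_on_verts G"
    and lim: "\<And>f. \<forall>u v. {u, v} \<in> edges G \<longrightarrow> D u v \<bullet> (f u - f v) = 0 \<Longrightarrow> trivial_motion (verts G) P0 f"
  shows "\<exists>\<delta>>0. \<forall>q c f. (\<forall>v\<in>verts G. dist (q v) (P0 v) < \<delta>) \<longrightarrow>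
    (\<forall>u v. {u, v} \<in> edges G \<longrightarrow> dist (c u v *\<^sub>R (q u - q v)) (D u v) < \<delta>) \<longrightarrow>
    infinitesimal_motion G q f \<longrightarrow> trivial_motion (verts G) q f"
proof (rule ccontr)
  define V where "V = verts G"
  have finV: "finite V" and EV: "\<And>u v. {u, v} \<in> edges G \<Longrightarrow> u \<in> V \<and> v \<in> V"
    using G by (auto simp: graph_on_verts_def V_def)
  assume neg: "\<not> ?thesis"
  have neg': "\<exists>q c f. (\<forall>v\<in>V. dist (q v) (P0 v) < \<delta>) \<and>
    (\<forall>u v. {u, v} \<in> edges G \<longrightarrow> dist (c u v *\<^sub>R (q u - q v)) (D u v) < \<delta>) \<and>
    infinitesimal_motion G q f \<and> \<not> trivial_motion V q f" if "\<delta> > 0" for \<delta>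
    using spec[OF neg[unfolded not_ex V_def[symmetric]], of \<delta>] that
    by (simp only: de_Morgan_conj not_all not_imp simp_thms)
  have "\<forall>n. \<exists>q c f. (\<forall>v\<in>V. dist (q v) (P0 v) < inverse (real (Suc n))) \<and>
    (\<forall>u v. {u, v} \<in> edges G \<longrightarrow> dist (c u v *\<^sub>R (q u - q v)) (D u v) < inverse (real (Suc n))) \<and>
    infinitesimal_motion G q f \<and> \<not> trivial_motion V q f"
    by (intro allI neg') simp
  then obtain q c f where q: "\<And>n v. v \<in> V \<Longrightarrow> dist (q n v) (P0 v) < inverse (real (Suc n))"
    and c: "\<And>n u v. {u, v} \<in> edges G \<Longrightarrow> dist (c n u v *\<^sub>R (q n u - q n v)) (D u v) < inverse (real (Suc n))"
    and f: "\<And>n. infinitesimal_motion G (q n) (f n)" "\<And>n. \<not> trivial_motion V (q n) (f n)"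
    by metis
  have "\<exists>g. \<forall>n. trivial_motion V (q n) (\<lambda>v. f n v - g n v) \<and>
    (\<forall>M b. skew M \<longrightarrow> (\<Sum>v\<in>V. g n v \<bullet> (M *v q n v + b)) = 0)"
    by (intro choice allI project_off_trivial[OF finV])
  then obtain g where g: "\<And>n. trivial_motion V (q n) (\<lambda>v. f n v - g n v)"
    "\<And>n M b. skew M \<Longrightarrow> (\<Sum>v\<in>V. g n v \<bullet> (M *v q n v + b)) = 0"
    by blast
  have g_inf: "(q n u - q n v) \<bullet> (g n u - g n v) = 0" if "{u, v} \<in> edges G" for n u v
  proof -
    have "(q n u - q n v) \<bullet> ((f n u - g n u) - (f n v - g n v)) = 0" "(q n u - q n v) \<bullet> (f n u - f n v) = 0"
      using trivial_motion_infinitesimal[OF G g(1)[of n, unfolded V_def]] f(1)[of n] that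
      unfolding infinitesimal_motion_def by blast+
    then show ?thesis by (simp add: inner_diff_right)
  qed
  define N where "N n = sqrt (\<Sum>v\<in>V. g n v \<bullet> g n v)" for n
  have N2: "(N n)\<^sup>2 = (\<Sum>v\<in>V. g n v \<bullet> g n v)" for n
    by (simp add: N_def sum_nonneg)
  have N: "N n > 0" for n
  proof (rule ccontr)
    assume "\<not> N n > 0"
    then have "(\<Sum>v\<in>V. g n v \<bullet> g n v) = 0"
      by (metis N_def less_eq_real_def linorder_not_less order_antisym_conv real_sqrt_eq_zero_cancel_iff real_sqrt_ge_zero sum_nonneg inner_ge_zero)
    then have "\<forall>v\<in>V. g n v = 0" using finV by (simp add: sum_nonneg_eq_0_iff)
    then have "trivial_motion V (q n) (f n)" using g(1)[of n] by (simp add: trivial_motion_def)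
    then show False using f(2) by blast
  qed
  define h where "h n v = g n v /\<^sub>R N n" for n v
  have h1: "(\<Sum>v\<in>V. h n v \<bullet> h n v) = 1" for n
  proof -
    have "(\<Sum>v\<in>V. h n v \<bullet> h n v) = (\<Sum>v\<in>V. g n v \<bullet> g n v) / (N n)\<^sup>2"
      by (simp add: h_def sum_divide_distrib power2_eq_square divide_simps)
    then show ?thesis using N[of n] by (simp add: N2[symmetric])
  qed
  have "norm (h n v) \<le> 1" if "v \<in> V" for n v
  proof -
    have "h n v \<bullet> h n v \<le> (\<Sum>v\<in>V. h n v \<bullet> h n v)"
      using that finV by (intro member_le_sum) auto
    then show ?thesis unfolding h1 norm_le_square[of _ 1, simplified]
      by (simp add: norm_le_square)
  qed
  then have "bounded (range (\<lambda>n. h n v))" if "v \<in> V" for v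
    using that by (auto simp: bounded_iff)
  from finite_family_convergent_subsequence[of V h, OF finV this]
  obtain r l where r: "strict_mono r" and l: "\<And>v. v \<in> V \<Longrightarrow> (\<lambda>n. h (r n) v) \<longlonglongrightarrow> l v"
    by blast
  have inv: "(\<lambda>n. inverse (real (Suc (r n)))) \<longlonglongrightarrow> 0"
    using LIMSEQ_subseq_LIMSEQ[OF LIMSEQ_inverse_real_of_nat r] by (simp add: o_def)
  have ql: "(\<lambda>n. q (r n) v) \<longlonglongrightarrow> P0 v" if "v \<in> V" for v
    by (rule metric_tendsto_imp_tendsto[OF inv]) (use q[OF that] in \<open>auto intro!: always_eventually less_imp_le\<close>)
  have cl: "(\<lambda>n. c (r n) u v *\<^sub>R (q (r n) u - q (r n) v)) \<longlonglongrightarrow> D u v" if "{u, v} \<in> edges G" for u v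
    by (rule metric_tendsto_imp_tendsto[OF inv]) (use c[OF that] in \<open>auto intro!: always_eventually less_imp_le\<close>)
  \<comment> \<open>Each rescaled edge vector is still orthogonal to the difference of the motion,
    so the equation survives the limit even when \<open>q u - q v\<close> itself tends to 0.\<close>
  have "D u v \<bullet> (l u - l v) = 0" if e: "{u, v} \<in> edges G" for u v
  proof (rule LIMSEQ_unique)
    show "(\<lambda>n. (c (r n) u v *\<^sub>R (q (r n) u - q (r n) v)) \<bullet> (h (r n) u - h (r n) v)) \<longlonglongrightarrow> D u v \<bullet> (l u - l v)"
      using EV[OF e] by (intro tendsto_intros cl[OF e] l) auto
    have "(c (r n) u v *\<^sub>R (q (r n) u - q (r n) v)) \<bullet> (h (r n) u - h (r n) v) = 0" for n
      using g_inf[OF e, of "r n"] by (simp add: h_def scaleR_diff_right[symmetric])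
    then show "(\<lambda>n. (c (r n) u v *\<^sub>R (q (r n) u - q (r n) v)) \<bullet> (h (r n) u - h (r n) v)) \<longlonglongrightarrow> 0"
      by (simp only: tendsto_const)
  qed
  then have "trivial_motion V P0 l" using lim[of l] by (auto simp: V_def)
  then obtain M b where M: "skew M" "\<And>v. v \<in> V \<Longrightarrow> l v = M *v P0 v + b"
    by (auto simp: trivial_motion_def)
  \<comment> \<open>The limit \<open>l\<close> is orthogonal to every trivial motion at
    \<open>P0\<close> and is one itself, hence orthogonal to itself; this contradicts the
    normalisation \<open>h1\<close>.\<close>
  have "(\<lambda>n. \<Sum>v\<in>V. h (r n) v \<bullet> (M *v q (r n) v + b)) \<longlonglongrightarrow> (\<Sum>v\<in>V. l v \<bullet> (M *v P0 v + b))"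
    by (intro tendsto_intros l bounded_linear.tendsto[OF matrix_vector_mul_bounded_linear] ql)
  moreover have "(\<Sum>v\<in>V. h (r n) v \<bullet> (M *v q (r n) v + b)) = 0" for n
    using g(2)[OF M(1), of "r n" b] by (simp add: h_def sum_distrib_left[symmetric])
  ultimately have "(\<Sum>v\<in>V. l v \<bullet> (M *v P0 v + b)) = 0"
    by (simp add: LIMSEQ_const_iff)
  then have "(\<Sum>v\<in>V. l v \<bullet> l v) = 0" using M(2) by simp
  moreover have "(\<lambda>n. \<Sum>v\<in>V. h (r n) v \<bullet> h (r n) v) \<longlonglongrightarrow> (\<Sum>v\<in>V. l v \<bullet> l v)"
    by (intro tendsto_intros l)
  ultimately show False by (simp add: h1 LIMSEQ_const_iff)
qed

section \<open>Infinitesimal rigidity implies rigidity\<close>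

definition rigid_motion :: "(real ^ 'n \<Rightarrow> real ^ 'n) \<Rightarrow> bool" where
  "rigid_motion \<phi> \<longleftrightarrow> surj \<phi> \<and> (\<forall>x y. dist (\<phi> x) (\<phi> y) = dist x y)"

lemma rigid_motion_comp: "rigid_motion \<phi> \<Longrightarrow> rigid_motion \<psi> \<Longrightarrow> rigid_motion (\<phi> \<circ> \<psi>)"
  unfolding rigid_motion_def by (metis comp_surj comp_apply)

lemma rigid_motion_inv:
  assumes "rigid_motion \<phi>"
  shows "rigid_motion (inv \<phi>)" "inv \<phi> (\<phi> x) = x" "\<phi> (inv \<phi> x) = x"
proof -
  have s: "surj \<phi>" and d: "\<And>x y. dist (\<phi> x) (\<phi> y) = dist x y"
    using assms by (auto simp: rigid_motion_def)
  have "inj \<phi>"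
    by (rule injI) (metis d dist_eq_0_iff)
  then show 1: "inv \<phi> (\<phi> x) = x" by simp
  show 2: "\<phi> (inv \<phi> x) = x" using s by (simp add: surj_f_inv_f)
  have "dist (inv \<phi> x) (inv \<phi> y) = dist x y" for x y
    using d[of "inv \<phi> x" "inv \<phi> y"] s by (simp add: surj_f_inv_f)
  moreover have "surj (inv \<phi>)" using \<open>inj \<phi>\<close> by (rule inj_imp_surj_inv)
  ultimately show "rigid_motion (inv \<phi>)" by (simp add: rigid_motion_def)
qed

text \<open>The Cayley transform: \<open>q - p = M (p + q) / 2 + b\<close> with \<open>M\<close> skew means
  \<open>q = (I - M / 2)\<^sup>-\<^sup>1 ((I + M / 2) p + b)\<close>, and \<open>(I - M / 2)\<^sup>-\<^sup>1 (I + M / 2)\<close> is orthogonal.\<close>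

lemma rigid_motion_of_trivial_motion:
  fixes p q :: "'a \<Rightarrow> real ^ 'n"
  assumes "trivial_motion V (\<lambda>v. (1/2) *\<^sub>R (p v + q v)) (\<lambda>v. q v - p v)"
  shows "\<exists>\<phi>. rigid_motion \<phi> \<and> (\<forall>v\<in>V. q v = \<phi> (p v))"
proof -
  obtain M :: "real ^ 'n ^ 'n" and b where M: "skew M"
    and pq: "\<And>v. v \<in> V \<Longrightarrow> q v - p v = M *v ((1/2) *\<^sub>R (p v + q v)) + b"
    using assms by (auto simp: trivial_motion_def)
  define T where "T x = x - M *v ((1/2) *\<^sub>R x)" for x
  define U where "U x = x + M *v ((1/2) *\<^sub>R x)" for x
  have lin: "linear T" "linear U"
    unfolding T_def U_def
    by (intro linear_compose_sub linear_compose_add linear_ident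
        linear_compose[OF linear_scale_self matrix_vector_mul_linear, unfolded o_def])+
  have sk: "(M *v ((1/2) *\<^sub>R x)) \<bullet> x = 0" for x
    using M by (simp add: skew_def matrix_vector_mult_scaleR)
  have zero: "x = 0" if "T x = 0 \<or> U x = 0" for x
  proof -
    have "T x \<bullet> x = x \<bullet> x" "U x \<bullet> x = x \<bullet> x"
      by (simp_all add: T_def U_def inner_diff_left inner_add_left sk)
    then show ?thesis using that by auto
  qed
  have inj: "inj T" "inj U"
    unfolding linear_injective_0[OF lin(1)] linear_injective_0[OF lin(2)] using zero by blast+
  then have surj: "surj T" "surj U"
    using lin linear_injective_imp_surjective by blast+
  \<comment> \<open>\<open>T y = U x\<close> says that \<open>y - x\<close> is the image of
    \<open>(y + x) / 2\<close> under \<open>M\<close>, which is orthogonal to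
    \<open>y + x\<close>.\<close>
  have norm_eq: "norm y = norm x" if "T y = U x" for x y
  proof -
    have "y - x = M *v ((1/2) *\<^sub>R (y + x))"
      using that by (simp add: T_def U_def matrix_vector_right_distrib scaleR_add_right algebra_simps)
    then have "(y - x) \<bullet> (y + x) = 0" using sk[of "y + x"] by simp
    then have "y \<bullet> y = x \<bullet> x"
      unfolding inner_diff_left inner_add_right by (simp add: inner_commute[of x y])
    then show ?thesis by (simp add: norm_eq_sqrt_inner)
  qed
  define \<phi> where "\<phi> x = inv T (U x + b)" for x
  have T\<phi>: "T (\<phi> x) = U x + b" for x using surj by (simp add: \<phi>_def surj_f_inv_f)
  have "dist (\<phi> x) (\<phi> y) = dist x y" for x y
  proof -
    have "T (\<phi> x - \<phi> y) = U (x - y)"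
      by (simp add: linear_diff[OF lin(1)] linear_diff[OF lin(2)] T\<phi>)
    then show ?thesis using norm_eq by (simp add: dist_norm)
  qed
  moreover have "surj \<phi>"
  proof (rule surjI)
    fix y
    show "\<phi> (inv U (T y - b)) = y"
      using inj surj by (simp add: \<phi>_def surj_f_inv_f)
  qed
  moreover have "q v = \<phi> (p v)" if "v \<in> V" for v
  proof -
    have "T (q v) = U (p v) + b"
      using pq[OF that] by (simp add: T_def U_def matrix_vector_right_distrib scaleR_add_right algebra_simps)
    then show ?thesis using inj by (simp add: \<phi>_def inv_f_eq)
  qed
  ultimately show ?thesis by (auto simp: rigid_motion_def)
qed

text \<open>With \<open>a\<close> and \<open>b\<close> the edge vectors at \<open>p\<close> and
  \<open>q\<close>, the left side is \<open>((a + b) / 2) \<bullet> (b - a)\<close>, a difference of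
  two squares.\<close>

lemma inner_midpoint_diff:
  fixes p q :: "'a \<Rightarrow> 'b::real_inner"
  shows "((1/2) *\<^sub>R (p u + q u) - (1/2) *\<^sub>R (p v + q v)) \<bullet> ((q u - p u) - (q v - p v)) =
    ((dist (q u) (q v))\<^sup>2 - (dist (p u) (p v))\<^sup>2) / 2"
proof -
  define a b where "a = p u - p v" and "b = q u - q v"
  have "(1/2) *\<^sub>R (p u + q u) - (1/2) *\<^sub>R (p v + q v) = (1/2) *\<^sub>R (a + b)"
    "(q u - p u) - (q v - p v) = b - a"
    by (simp_all add: a_def b_def algebra_simps)
  then have "((1/2) *\<^sub>R (p u + q u) - (1/2) *\<^sub>R (p v + q v)) \<bullet> ((q u - p u) - (q v - p v)) =
      ((1/2) *\<^sub>R (a + b)) \<bullet> (b - a)"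
    by (simp only:)
  also have "\<dots> = (b \<bullet> b - a \<bullet> a) / 2"
    by (simp add: inner_add_left inner_diff_right inner_commute[of b a] field_simps)
  finally show ?thesis
    by (simp add: dist_norm power2_norm_eq_inner a_def b_def)
qed

lemma inner_midpoint_diff_eq_0_iff:
  fixes p q :: "'a \<Rightarrow> 'b::real_inner"
  shows "((1/2) *\<^sub>R (p u + q u) - (1/2) *\<^sub>R (p v + q v)) \<bullet> ((q u - p u) - (q v - p v)) = 0 \<longleftrightarrow>
    dist (q u) (q v) = dist (p u) (p v)"
  unfolding inner_midpoint_diff by (simp add: power2_eq_iff_nonneg)

text \<open>Near \<open>p\<close>, a placement with the same edge lengths is congruent to
  \<open>p\<close>: the midpoint placement is still infinitesimally rigid, so \<open>q - p\<close>
  is trivial there. A motion is cut into steps short enough for this local statement.\<close>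

lemma infinitesimally_rigid_imp_rigid:
  fixes p :: "'a \<Rightarrow> real ^ 'n"
  assumes G: "graph_on_verts G"
    and inf: "\<And>f. infinitesimal_motion G p f \<Longrightarrow> trivial_motion (verts G) p f"
  shows "rigid_framework G p"
proof -
  have finV: "finite (verts G)" and EV: "\<And>u v. {u, v} \<in> edges G \<Longrightarrow> u \<in> verts G \<and> v \<in> verts G"
    using G by (auto simp: graph_on_verts_def)
  have "\<exists>\<delta>>0. \<forall>q c f. (\<forall>v\<in>verts G. dist (q v) (p v) < \<delta>) \<longrightarrow>
    (\<forall>u v. {u, v} \<in> edges G \<longrightarrow> dist (c u v *\<^sub>R (q u - q v)) (p u - p v) < \<delta>) \<longrightarrow>
    infinitesimal_motion G q f \<longrightarrow> trivial_motion (verts G) q f"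
    by (rule trivial_motions_nearby[OF G]) (use inf in \<open>simp add: infinitesimal_motion_def\<close>)
  then obtain \<delta> where "\<delta> > 0" and \<delta>: "\<And>q c f. \<lbrakk>\<forall>v\<in>verts G. dist (q v) (p v) < \<delta>;
      \<forall>u v. {u, v} \<in> edges G \<longrightarrow> dist (c u v *\<^sub>R (q u - q v)) (p u - p v) < \<delta>;
      infinitesimal_motion G q f\<rbrakk> \<Longrightarrow> trivial_motion (verts G) q f"
    by blast
  have local: "\<exists>\<phi>. rigid_motion \<phi> \<and> (\<forall>v\<in>verts G. q v = \<phi> (p v))"
    if near: "\<And>v. v \<in> verts G \<Longrightarrow> dist (q v) (p v) < \<delta>"
      and eq: "\<And>u v. {u, v} \<in> edges G \<Longrightarrow> dist (q u) (q v) = dist (p u) (p v)" for q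
  proof (rule rigid_motion_of_trivial_motion, rule \<delta>[where c = "\<lambda>_ _. 1"])
    let ?m = "\<lambda>v. (1/2) *\<^sub>R (p v + q v)"
    have m: "?m v - p v = (1/2) *\<^sub>R (q v - p v)" for v
      by (simp add: vec_eq_iff field_simps)
    \<comment> \<open>Each midpoint moves by half the displacement, so the errors at the two ends of
      an edge add up to less than \<open>\<delta>\<close>, as the condition on edge vectors
      demands.\<close>
    have half: "dist (?m v) (p v) < \<delta> / 2" if "v \<in> verts G" for v
      using near[OF that] unfolding dist_norm m by simp
    then show "\<forall>v\<in>verts G. dist (?m v) (p v) < \<delta>" using \<open>\<delta> > 0\<close> by fastforce
    show "\<forall>u v. {u, v} \<in> edges G \<longrightarrow> dist (1 *\<^sub>R (?m u - ?m v)) (p u - p v) < \<delta>"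
    proof (intro allI impI)
      fix u v assume "{u, v} \<in> edges G"
      then have "dist (?m u) (p u) < \<delta> / 2" "dist (?m v) (p v) < \<delta> / 2" using EV half by auto
      then show "dist (1 *\<^sub>R (?m u - ?m v)) (p u - p v) < \<delta>"
        unfolding scaleR_one dist_norm using norm_triangle_ineq4[of "?m u - p u" "?m v - p v"]
        by (simp only: diff_diff_eq2 algebra_simps)
    qed
    show "infinitesimal_motion G ?m (\<lambda>v. q v - p v)"
      unfolding infinitesimal_motion_def inner_midpoint_diff_eq_0_iff using eq by blast
  qed
  show ?thesis
    unfolding rigid_framework_def
  proof (intro allI impI)
    fix q assume q: "motion G p q"
    then have q0: "\<And>v. v \<in> verts G \<Longrightarrow> q 0 v = p v"
      and qE: "\<And>t u v. t \<in> {0..1} \<Longrightarrow> {u, v} \<in> edges G \<Longrightarrow> dist (q t u) (q t v) = dist (p u) (p v)"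
      by (auto simp: motion_def)
    have "\<exists>\<eta>>0. \<forall>s\<in>{0..1}. \<forall>t\<in>{0..1}. dist t s < \<eta> \<longrightarrow> dist (q t v) (q s v) < \<delta>" if "v \<in> verts G" for v
    proof -
      have "uniformly_continuous_on {0..1::real} (\<lambda>t. q t v)"
        using q that by (intro compact_uniformly_continuous) (auto simp: motion_def)
      then show ?thesis using \<open>\<delta> > 0\<close> unfolding uniformly_continuous_on_def by blast
    qed
    then obtain \<eta> where \<eta>: "\<And>v. v \<in> verts G \<Longrightarrow> \<eta> v > 0"
      "\<And>v s t. \<lbrakk>v \<in> verts G; s \<in> {0..1}; t \<in> {0..1}; dist t s < \<eta> v\<rbrakk> \<Longrightarrow> dist (q t v) (q s v) < \<delta>"
      by metis
    \<comment> \<open>Inserting 1 keeps \<open>Min\<close> meaningful for an empty vertex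
      set.\<close>
    define \<eta>0 where "\<eta>0 = Min (insert 1 (\<eta> ` verts G))"
    have "\<eta>0 > 0" using finV \<eta>(1) by (auto simp: \<eta>0_def)
    have \<eta>0: "\<eta>0 \<le> \<eta> v" if "v \<in> verts G" for v using finV that by (simp add: \<eta>0_def)
    define h where "h = \<eta>0 / 2"
    have h: "h > 0" "h < \<eta>0" using \<open>\<eta>0 > 0\<close> by (auto simp: h_def)
    have step: "\<exists>\<phi>. rigid_motion \<phi> \<and> (\<forall>v\<in>verts G. q t v = \<phi> (p v))"
      if "t \<in> {0..1}" "t \<le> real k * h" for k t
      using that
    proof (induction k arbitrary: t)
      case 0
      then have "t = 0" by simp
      then show ?case using q0 by (intro exI[of _ id]) (auto simp: rigid_motion_def)
    next
      case (Suc k)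
      define s where "s = min t (real k * h)"
      have s: "s \<in> {0..1}" "s \<le> real k * h" "dist t s < \<eta>0"
        using Suc.prems h by (auto simp: s_def dist_real_def min_def algebra_simps)
      obtain \<phi> where \<phi>: "rigid_motion \<phi>" "\<And>v. v \<in> verts G \<Longrightarrow> q s v = \<phi> (p v)"
        using Suc.IH[OF s(1,2)] by blast
      note inv = rigid_motion_inv[OF \<phi>(1)]
      \<comment> \<open>The inverse of the isometry reached so far carries the placement at time
        \<open>s\<close> back to \<open>p\<close>, so one radius \<open>\<delta>\<close> serves all
        steps.\<close>
      have "\<exists>\<psi>. rigid_motion \<psi> \<and> (\<forall>v\<in>verts G. inv \<phi> (q t v) = \<psi> (p v))"
      proof (rule local)
        fix v assume v: "v \<in> verts G"
        have "dist (inv \<phi> (q t v)) (inv \<phi> (q s v)) = dist (q t v) (q s v)"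
          using inv(1) by (simp add: rigid_motion_def)
        also have "\<dots> < \<delta>" using \<eta>(2)[OF v s(1) Suc.prems(1)] \<eta>0[OF v] s(3) by simp
        finally show "dist (inv \<phi> (q t v)) (p v) < \<delta>" by (simp add: \<phi>(2)[OF v] inv(2))
      next
        fix u v assume "{u, v} \<in> edges G"
        then show "dist (inv \<phi> (q t u)) (inv \<phi> (q t v)) = dist (p u) (p v)"
          using inv(1) qE[OF Suc.prems(1)] by (simp add: rigid_motion_def)
      qed
      then obtain \<psi> where \<psi>: "rigid_motion \<psi>" "\<And>v. v \<in> verts G \<Longrightarrow> inv \<phi> (q t v) = \<psi> (p v)" by blast
      have "q t v = (\<phi> \<circ> \<psi>) (p v)" if "v \<in> verts G" for v
        using \<psi>(2)[OF that] inv(3)[of "q t v"] by simp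
      then show ?case using rigid_motion_comp[OF \<phi>(1) \<psi>(1)] by blast
    qed
    show "\<forall>t\<in>{0..1}. \<forall>u\<in>verts G. \<forall>v\<in>verts G. dist (q t u) (q t v) = dist (p u) (p v)"
    proof (intro ballI)
      fix t :: real and u v assume *: "t \<in> {0..1}" "u \<in> verts G" "v \<in> verts G"
      obtain k where "1 \<le> real k * h" using reals_Archimedean3[OF h(1), rule_format, of 1] less_imp_le by blast
      then obtain \<phi> where "rigid_motion \<phi>" "\<forall>v\<in>verts G. q t v = \<phi> (p v)"
        using step[of t k] * by force
      then show "dist (q t u) (q t v) = dist (p u) (p v)" using * by (simp add: rigid_motion_def)
    qed
  qed
qed

section \<open>Generic rigidity implies infinitesimal rigidity\<close>

definition coords :: "('v \<Rightarrow> real ^ 'n) \<Rightarrow> 'v \<times> 'n \<Rightarrow> real" where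
  "coords p = (\<lambda>(v, k). p v $ k)"

text \<open>Members are vector-valued functions on \<open>W\<close>: for \<open>W = V\<close> they
  will be rows of a rigidity matrix, for \<open>W = {()}\<close> they are single vectors.\<close>

definition independent_family :: "'w set \<Rightarrow> 'j set \<Rightarrow> ('j \<Rightarrow> 'w \<Rightarrow> 'b::real_vector) \<Rightarrow> bool" where
  "independent_family W J t \<longleftrightarrow> (\<forall>c. (\<forall>w\<in>W. (\<Sum>j\<in>J. c j *\<^sub>R t j w) = 0) \<longrightarrow> (\<forall>j\<in>J. c j = 0))"

definition polynomial_family ::
    "'v set \<Rightarrow> 'w set \<Rightarrow> 'j set \<Rightarrow> (('v \<Rightarrow> real ^ 'n) \<Rightarrow> 'j \<Rightarrow> 'w \<Rightarrow> real ^ 'n) \<Rightarrow> bool" where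
  "polynomial_family V W J t \<longleftrightarrow> (\<forall>j\<in>J. \<forall>w\<in>W. \<forall>k. \<exists>F. polyfun (V \<times> UNIV) F \<and> (\<forall>p. t p j w $ k = F (coords p)))"

text \<open>\<open>D\<close> comes from elimination at \<open>p0\<close>. Being one polynomial in
  the coordinates, it serves twice: genericity transfers independence from any special placement,
  and continuity preserves it nearby.\<close>

lemma polynomial_family_independent:
  assumes "finite J" "polynomial_family V W J t" "independent_family W J (t p0)"
  shows "\<exists>D. polyfun (V \<times> UNIV) D \<and> D (coords p0) \<noteq> 0 \<and>
    (\<forall>p. D (coords p) \<noteq> 0 \<longrightarrow> independent_family W J (t p))"
proof -
  have "\<forall>j w k. \<exists>F. j \<in> J \<longrightarrow> w \<in> W \<longrightarrow> polyfun (V \<times> UNIV) F \<and> (\<forall>p. t p j w $ k = F (coords p))"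
    using assms(2) unfolding polynomial_family_def by blast
  then obtain R where R: "\<And>j w k. j \<in> J \<Longrightarrow> w \<in> W \<Longrightarrow> polyfun (V \<times> UNIV) (R j w k)"
    "\<And>j w k p. j \<in> J \<Longrightarrow> w \<in> W \<Longrightarrow> t p j w $ k = R j w k (coords p)"
    by metis
  define row where "row j = (\<lambda>(w, k). R j w k)" for j
  have row: "polyfun (V \<times> UNIV) (row j x)" if "j \<in> J" "x \<in> W \<times> UNIV" for j x
    using that R(1) by (cases x) (simp add: row_def)
  have iff: "(\<forall>w\<in>W. (\<Sum>j\<in>J. c j *\<^sub>R t p j w) = 0) \<longleftrightarrow>
      (\<forall>k\<in>W \<times> UNIV. (\<Sum>j\<in>J. c j * row j k (coords p)) = 0)" for c p
    by (simp add: vec_eq_iff row_def R(2)[symmetric])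
  show ?thesis
    using polyfun_rows_independent[of J "W \<times> UNIV" "V \<times> UNIV" row "coords p0", OF assms(1) row]
      assms(3)
    unfolding independent_family_def iff by blast
qed

text \<open>Also used in contrapositive form: rows dependent at a generic placement are dependent at
  every placement.\<close>

lemma generic_independent_family:
  assumes "finite J" "polynomial_family V W J t" "independent_family W J (t p0)" "generic V p"
  shows "independent_family W J (t p)"
proof -
  obtain D where D: "polyfun (V \<times> UNIV) D" "D (coords p0) \<noteq> 0"
    "\<And>p. D (coords p) \<noteq> 0 \<Longrightarrow> independent_family W J (t p)"
    using polynomial_family_independent[OF assms(1-3)] by blast
  have "D (coords p) \<noteq> 0"
    using polyfun_independent_zero[OF _ D(1), of "coords p" "coords p0"] assms(4) D(2)
    by (auto simp: generic_def coords_def)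
  then show ?thesis by (rule D(3))
qed

lemma eventually_independent_family:
  assumes "finite J" "polynomial_family V W J t" "independent_family W J (t p)"
    and "\<And>v. v \<in> V \<Longrightarrow> ((\<lambda>s. q s v) \<longlongrightarrow> p v) net"
  shows "\<forall>\<^sub>F s in net. independent_family W J (t (q s))"
proof -
  obtain D where D: "polyfun (V \<times> UNIV) D" "D (coords p) \<noteq> 0"
    "\<And>p. D (coords p) \<noteq> 0 \<Longrightarrow> independent_family W J (t p)"
    using polynomial_family_independent[OF assms(1-3)] by blast
  have "((\<lambda>s. D (coords (q s))) \<longlongrightarrow> D (coords p)) net"
    by (rule polyfun_tendsto[OF D(1)]) (auto simp: coords_def intro!: tendsto_intros assms(4))
  then have "\<forall>\<^sub>F s in net. D (coords (q s)) \<noteq> 0"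
    using D(2) by (rule tendsto_imp_eventually_ne)
  then show ?thesis by (rule eventually_mono) (rule D(3))
qed

text \<open>The row of the rigidity matrix for an oriented edge \<open>(u, v)\<close>:
  \<open>p u - p v\<close> in block \<open>u\<close> and its negative in block
  \<open>v\<close>.\<close>

definition rigidity_row :: "('v \<Rightarrow> real ^ 'n) \<Rightarrow> 'v \<times> 'v \<Rightarrow> 'v \<Rightarrow> real ^ 'n" where
  "rigidity_row p e w = (of_bool (w = fst e) - of_bool (w = snd e)) *\<^sub>R (p (fst e) - p (snd e))"

lemma rigidity_row_inner:
  assumes "finite V" "u \<in> V" "v \<in> V"
  shows "(\<Sum>w\<in>V. rigidity_row p (u, v) w \<bullet> f w) = (p u - p v) \<bullet> (f u - f v)"
proof -
  have "(\<Sum>w\<in>V. rigidity_row p (u, v) w \<bullet> f w) =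
      (\<Sum>w\<in>V. (if w = u then (p u - p v) \<bullet> f w else 0) - (if w = v then (p u - p v) \<bullet> f w else 0))"
    by (rule sum.cong) (auto simp: rigidity_row_def)
  then show ?thesis using assms by (simp add: sum_subtractf inner_diff_right)
qed

lemma polynomial_family_rigidity_row:
  assumes "F \<subseteq> V \<times> V"
  shows "polynomial_family V W F (rigidity_row :: ('v \<Rightarrow> real ^ 'n) \<Rightarrow> _)"
  unfolding polynomial_family_def
proof (intro ballI allI)
  fix e w and k :: 'n assume "e \<in> F" "w \<in> W"
  define c :: rat where "c = of_bool (w = fst e) - of_bool (w = snd e)"
  have "fst e \<in> V" "snd e \<in> V" using \<open>e \<in> F\<close> assms by auto
  then have "polyfun (V \<times> UNIV) (\<lambda>x. of_rat c * (x (fst e, k) - x (snd e, k)))"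
    by (intro polyfun_mult polyfun_const polyfun_diff polyfun_var) auto
  moreover have "rigidity_row p e w $ k = of_rat c * (coords p (fst e, k) - coords p (snd e, k))"
    for p :: "'v \<Rightarrow> real ^ 'n"
    by (simp add: rigidity_row_def coords_def c_def of_rat_diff of_bool_def)
  ultimately show "\<exists>G. polyfun (V \<times> UNIV) G \<and> (\<forall>p. rigidity_row p e w $ k = G (coords p))"
    by (intro exI conjI allI)
qed

text \<open>For \<open>t > 0\<close>, moving an edge vector \<open>z\<close> to
  \<open>z + t *\<^sub>R x\<close> keeps its length iff
  \<open>z \<bullet> x = - (t / 2) * (norm x)\<^sup>2\<close>. With dual correction vectors the left
  side becomes the coefficient \<open>b t e\<close>, and the system turns into this fixed-point
  equation. For small \<open>t\<close> its iteration is a contraction.\<close>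

lemma quadratic_fixed_point_curve:
  fixes w :: "'e \<Rightarrow> 'b::real_inner" and s :: "'e \<Rightarrow> 'e \<Rightarrow> 'b"
  assumes "finite F"
  shows "\<exists>\<tau>>0. \<exists>b. \<forall>e\<in>F. continuous_on {0..\<tau>} (\<lambda>t. b t e) \<and>
    (\<forall>t\<in>{0..\<tau>}. b t e = - (t / 2) * (norm (w e + (\<Sum>e'\<in>F. b t e' *\<^sub>R s e e')))\<^sup>2)"
proof -
  define X where "X b e = w e + (\<Sum>e'\<in>F. b e' *\<^sub>R s e e')" for b e
  define B :: "real \<Rightarrow> nat \<Rightarrow> 'e \<Rightarrow> real"
    where "B t = rec_nat (\<lambda>_. 0) (\<lambda>_ b e. - (t / 2) * (norm (X b e))\<^sup>2)" for t
  have B0: "B t 0 e = 0" for t e by (simp add: B_def)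
  have BSuc: "B t (Suc k) e = - (t / 2) * (norm (X (B t k) e))\<^sup>2" for t k e by (simp add: B_def)
  \<comment> \<open>\<open>K\<close> bounds every \<open>X b e\<close> on the box where all
    coefficients have absolute value at most 1, and is a Lipschitz constant of \<open>X\<close>. The
    summand 1 makes it positive.\<close>
  define K where "K = 1 + (\<Sum>e\<in>F. norm (w e) + (\<Sum>e'\<in>F. norm (s e e')))"
  have K1: "K \<ge> 1" by (simp add: K_def sum_nonneg)
  have Ke: "norm (w e) + (\<Sum>e'\<in>F. norm (s e e')) \<le> K" if "e \<in> F" for e
  proof -
    have "norm (w e) + (\<Sum>e'\<in>F. norm (s e e')) \<le> (\<Sum>e\<in>F. norm (w e) + (\<Sum>e'\<in>F. norm (s e e')))"
      by (rule member_le_sum[OF that _ assms]) (simp add: sum_nonneg)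
    then show ?thesis by (simp add: K_def)
  qed
  have lin: "norm (\<Sum>e'\<in>F. b e' *\<^sub>R s e e') \<le> m * (\<Sum>e'\<in>F. norm (s e e'))"
    if "\<And>e. e \<in> F \<Longrightarrow> \<bar>b e\<bar> \<le> m" for b m e
    unfolding sum_distrib_left
    by (rule order_trans[OF norm_sum sum_mono]) (use that in \<open>auto intro: mult_right_mono\<close>)
  have XK: "norm (X b e) \<le> K" if "\<And>e. e \<in> F \<Longrightarrow> \<bar>b e\<bar> \<le> 1" "e \<in> F" for b e
    using norm_triangle_ineq[of "w e" "\<Sum>e'\<in>F. b e' *\<^sub>R s e e'"] lin[of b 1 e] that Ke[OF that(2)]
    by (simp add: X_def)
  have XL: "\<bar>(norm (X b e))\<^sup>2 - (norm (X b' e))\<^sup>2\<bar> \<le> 2 * K\<^sup>2 * m"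
    if b: "\<And>e. e \<in> F \<Longrightarrow> \<bar>b e\<bar> \<le> 1" "\<And>e. e \<in> F \<Longrightarrow> \<bar>b' e\<bar> \<le> 1"
      and m: "\<And>e. e \<in> F \<Longrightarrow> \<bar>b e - b' e\<bar> \<le> m" and e: "e \<in> F" for b b' m e
  proof -
    have "m \<ge> 0" using m[OF e] by linarith
    have "X b e - X b' e = (\<Sum>e'\<in>F. (b e' - b' e') *\<^sub>R s e e')"
      by (simp add: X_def scaleR_diff_left sum_subtractf)
    then have "norm (X b e - X b' e) \<le> m * (\<Sum>e'\<in>F. norm (s e e'))"
      using lin[of "\<lambda>e. b e - b' e" m e] m by simp
    also have "\<dots> \<le> m * K"
      using Ke[OF e] \<open>m \<ge> 0\<close> norm_ge_zero[of "w e"] by (intro mult_left_mono) linarith+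
    finally have 1: "\<bar>norm (X b e) - norm (X b' e)\<bar> \<le> m * K"
      using norm_triangle_ineq3[of "X b e" "X b' e"] by linarith
    have "\<bar>(norm (X b e))\<^sup>2 - (norm (X b' e))\<^sup>2\<bar> =
        \<bar>norm (X b e) - norm (X b' e)\<bar> * (norm (X b e) + norm (X b' e))"
      by (simp add: power2_eq_square square_diff_square_factored abs_mult mult.commute)
    also have "\<dots> \<le> (m * K) * (K + K)"
      using XK[OF b(1) e] XK[OF b(2) e] 1 K1 \<open>m \<ge> 0\<close> by (intro mult_mono add_mono) auto
    finally show ?thesis by (simp add: power2_eq_square algebra_simps)
  qed
  \<comment> \<open>On this interval \<open>t * K\<^sup>2 \<le> 1/2\<close>: the iterates stay in
    the box, and the factor \<open>t / 2 * (2 * K\<^sup>2)\<close> coming from \<open>XL\<close>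
    contracts by one half.\<close>
  define \<tau> where "\<tau> = 1 / (2 * K\<^sup>2)"
  have "\<tau> > 0" using K1 by (simp add: \<tau>_def)
  have tK: "t * K\<^sup>2 \<le> 1/2" if "t \<in> {0..\<tau>}" for t
  proof -
    have "t * K\<^sup>2 \<le> \<tau> * K\<^sup>2" using that by (intro mult_right_mono) auto
    then show ?thesis using K1 by (simp add: \<tau>_def)
  qed
  have bound: "\<forall>e\<in>F. \<bar>B t k e\<bar> \<le> 1" if t: "t \<in> {0..\<tau>}" for t k
  proof (induction k)
    case (Suc k)
    show ?case
    proof
      fix e assume "e \<in> F"
      then have "(norm (X (B t k) e))\<^sup>2 \<le> K\<^sup>2"
        using XK[of "B t k" e] Suc by (intro power_mono) auto
      then have "t * (norm (X (B t k) e))\<^sup>2 \<le> t * K\<^sup>2" using t by (intro mult_left_mono) auto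
      then show "\<bar>B t (Suc k) e\<bar> \<le> 1" using tK[OF t] t by (simp add: BSuc abs_mult)
    qed
  qed (simp add: B0)
  have diff: "\<forall>e\<in>F. \<bar>B t (Suc k) e - B t k e\<bar> \<le> (1/2) ^ k" if t: "t \<in> {0..\<tau>}" for t k
  proof (induction k)
    case 0
    then show ?case using bound[OF t, of "Suc 0"] by (simp add: B0)
  next
    case (Suc k)
    show ?case
    proof
      fix e assume e: "e \<in> F"
      have "B t (Suc (Suc k)) e - B t (Suc k) e =
          - (t / 2) * ((norm (X (B t (Suc k)) e))\<^sup>2 - (norm (X (B t k) e))\<^sup>2)"
        unfolding BSuc[of t "Suc k" e] BSuc[of t k e] by (simp only: right_diff_distrib)
      then have "\<bar>B t (Suc (Suc k)) e - B t (Suc k) e\<bar> =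
          t / 2 * \<bar>(norm (X (B t (Suc k)) e))\<^sup>2 - (norm (X (B t k) e))\<^sup>2\<bar>"
        using t by (simp only: abs_mult) simp
      also have "\<dots> \<le> t / 2 * (2 * K\<^sup>2 * (1/2) ^ k)"
        using XL[of "B t (Suc k)" "B t k" "(1/2) ^ k" e] bound[OF t] Suc e t
        by (intro mult_left_mono) auto
      also have "\<dots> = (t * K\<^sup>2) * (1/2) ^ k" by simp
      also have "\<dots> \<le> (1/2) * (1/2) ^ k" using tK[OF t] by (intro mult_right_mono) auto
      finally show "\<bar>B t (Suc (Suc k)) e - B t (Suc k) e\<bar> \<le> (1/2) ^ Suc k" by simp
    qed
  qed
  \<comment> \<open>The limit is written as a telescoping series dominated by a geometric one
    uniformly in \<open>t\<close>, which makes it continuous in \<open>t\<close>.\<close>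
  define b where "b t e = suminf (\<lambda>k. B t (Suc k) e - B t k e)" for t e
  have unif: "uniform_limit {0..\<tau>} (\<lambda>n t. B t n e) (\<lambda>t. b t e) sequentially" if e: "e \<in> F" for e
  proof -
    have "uniform_limit {0..\<tau>} (\<lambda>n t. \<Sum>k<n. B t (Suc k) e - B t k e) (\<lambda>t. b t e) sequentially"
      unfolding b_def
      by (rule Weierstrass_m_test[where M = "\<lambda>k. (1/2) ^ k"]) (use diff e in \<open>auto intro!: summable_geometric\<close>)
    moreover have "(\<Sum>k<n. B t (Suc k) e - B t k e) = B t n e" for n t
      using sum_lessThan_telescope[of "\<lambda>k. B t k e" n] by (simp add: B0)
    ultimately show ?thesis by simp
  qed
  have cont_B: "continuous_on {0..\<tau>} (\<lambda>t. B t n e)" for n e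
  proof (induction n arbitrary: e)
    case (Suc n)
    then show ?case unfolding BSuc X_def by (intro continuous_intros) auto
  qed (simp add: B0)
  have "continuous_on {0..\<tau>} (\<lambda>t. b t e)" if "e \<in> F" for e
    by (rule uniform_limit_theorem[OF _ unif[OF that]]) (auto simp: cont_B)
  moreover have "b t e = - (t / 2) * (norm (X (b t) e))\<^sup>2" if t: "t \<in> {0..\<tau>}" and e: "e \<in> F" for t e
  proof (rule LIMSEQ_unique)
    have lim: "(\<lambda>n. B t n e) \<longlonglongrightarrow> b t e" if "e \<in> F" for e
      using tendsto_uniform_limitI[OF unif[OF that] t] .
    then show "(\<lambda>n. B t (Suc n) e) \<longlonglongrightarrow> b t e" using e by (intro LIMSEQ_Suc) auto
    show "(\<lambda>n. B t (Suc n) e) \<longlonglongrightarrow> - (t / 2) * (norm (X (b t) e))\<^sup>2"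
      unfolding BSuc X_def by (intro tendsto_intros lim)
  qed
  ultimately show ?thesis using \<open>\<tau> > 0\<close> unfolding X_def by blast
qed

text \<open>If \<open>w\<close> is an infinitesimal motion of a generic framework, then correcting \<open>p + t w\<close> by
  vectors dual to a maximal independent set \<open>F\<close> of rows keeps the lengths of \<open>F\<close>. The remaining
  rows depend on \<open>F\<close> everywhere, so by the averaging principle their lengths are kept as well.\<close>

lemma generic_rigid_infinitesimal_motion:
  fixes p w :: "'a \<Rightarrow> real ^ 'n"
  assumes G: "graph_on_verts G" and gen: "generic (verts G) p" and rig: "rigid_framework G p"
    and w: "infinitesimal_motion G p w" and uv: "u0 \<in> verts G" "v0 \<in> verts G"
  shows "(p u0 - p v0) \<bullet> (w u0 - w v0) = 0"
proof -
  define V where "V = verts G"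
  define E where "E = {(u, v). {u, v} \<in> edges G}"
  have finV: "finite V" and EV: "E \<subseteq> V \<times> V"
    using G by (auto simp: graph_on_verts_def V_def E_def)
  then have finE: "finite E" by (meson finite_SigmaI finite_subset)
  let ?S = "{F. F \<subseteq> E \<and> independent_family V F (rigidity_row p)}"
  have "finite ?S" using finE by simp
  moreover have "{} \<in> ?S" by (simp add: independent_family_def)
  then have "?S \<noteq> {}" by blast
  ultimately have "\<exists>F\<in>?S. \<forall>F'\<in>?S. F \<subseteq> F' \<longrightarrow> F = F'"
    by (rule finite_has_maximal)
  then obtain F where F: "F \<in> ?S" and "\<forall>F'\<in>?S. F \<subseteq> F' \<longrightarrow> F = F'"
    by (rule bexE)
  then have F_max: "F = F'" if "F' \<in> ?S" "F \<subseteq> F'" for F'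
    using that by simp
  have finF: "finite F" and FV: "F \<subseteq> V \<times> V" using F finE EV by (auto intro: finite_subset)
  obtain s where s: "\<And>e e'. e \<in> F \<Longrightarrow> e' \<in> F \<Longrightarrow> (\<Sum>v\<in>V. rigidity_row p e v \<bullet> s e' v) = of_bool (e = e')"
    using dual_family[OF finF finV, of "rigidity_row p"] F unfolding independent_family_def by blast
  have s': "(p u - p v) \<bullet> (s e u - s e v) = of_bool ((u, v) = e)" if "(u, v) \<in> F" "e \<in> F" for u v e
    using s[OF that] rigidity_row_inner[OF finV, of u v p "s e"] that(1) FV by auto
  obtain \<tau> b where \<tau>: "\<tau> > 0" and b_cont: "\<And>e. e \<in> F \<Longrightarrow> continuous_on {0..\<tau>} (\<lambda>t. b t e)"
    and b: "\<And>e t. e \<in> F \<Longrightarrow> t \<in> {0..\<tau>} \<Longrightarrow> b t e = - (t / 2) *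
      (norm ((w (fst e) - w (snd e)) + (\<Sum>e'\<in>F. b t e' *\<^sub>R (s e' (fst e) - s e' (snd e)))))\<^sup>2"
    using quadratic_fixed_point_curve[OF finF, of "\<lambda>e. w (fst e) - w (snd e)"
        "\<lambda>e e'. s e' (fst e) - s e' (snd e)"] by blast
  \<comment> \<open>The corrected velocity. It tends to \<open>w\<close> as \<open>t\<close> tends
    to 0, because the coefficients \<open>b t e\<close> are continuous and vanish at 0.\<close>
  define y where "y t v = w v + (\<Sum>e\<in>F. b t e *\<^sub>R s e v)" for t v
  define q where "q t v = p v + t *\<^sub>R y t v" for t v
  define mid where "mid t v = (1/2) *\<^sub>R (p v + q t v)" for t v
  have y_cont: "continuous_on {0..\<tau>} (\<lambda>t. y t v)" for v
    unfolding y_def by (intro continuous_intros b_cont)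
  have q_cont: "continuous_on {0..\<tau>} (\<lambda>t. q t v)" for v
    unfolding q_def by (intro continuous_intros y_cont)
  have y0: "y 0 v = w v" for v
    using b[of _ 0] \<tau> by (simp add: y_def)
  have y_lim: "((\<lambda>t. y t v) \<longlongrightarrow> w v) (at_right 0)" for v
    using continuous_on_Icc_at_rightD[OF y_cont \<tau>, of v] by (simp add: y0)
  have mid_lim: "((\<lambda>t. mid t v) \<longlongrightarrow> p v) (at_right 0)" for v
  proof -
    have "((\<lambda>t. mid t v) \<longlongrightarrow> (1/2) *\<^sub>R (p v + (p v + 0 *\<^sub>R w v))) (at_right 0)"
      unfolding mid_def q_def by (intro tendsto_intros y_lim)
    then show ?thesis by (simp flip: scaleR_2)
  qed
  have mid_eq: "(mid t u - mid t v) \<bullet> ((q t u - p u) - (q t v - p v)) = 0 \<longleftrightarrow>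
      dist (q t u) (q t v) = dist (p u) (p v)" for t u v
    unfolding mid_def by (rule inner_midpoint_diff_eq_0_iff)
  have F_len: "dist (q t u) (q t v) = dist (p u) (p v)" if t: "t \<in> {0..\<tau>}" and e: "(u, v) \<in> F" for t u v
  proof -
    define x where "x = y t u - y t v"
    have x: "x = (w u - w v) + (\<Sum>e'\<in>F. b t e' *\<^sub>R (s e' u - s e' v))"
      by (simp add: x_def y_def scaleR_diff_right sum_subtractf)
    have "(p u - p v) \<bullet> (w u - w v) = 0"
      using w e F by (auto simp: infinitesimal_motion_def E_def)
    \<comment> \<open>Duality singles out the coefficient of the edge itself. It was solved for so
      that the linear and quadratic terms of the squared length cancel.\<close>
    then have "(p u - p v) \<bullet> x = (\<Sum>e'\<in>F. b t e' * of_bool ((u, v) = e'))"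
      unfolding x by (simp add: inner_add_right inner_sum_right s'[OF e])
    also have "\<dots> = (\<Sum>e'\<in>F. if e' = (u, v) then b t e' else 0)"
      by (rule sum.cong) auto
    also have "\<dots> = b t (u, v)" using e finF by simp
    also have "\<dots> = - (t / 2) * (norm x)\<^sup>2"
      using b[OF e t] by (simp add: x)
    finally have px: "(p u - p v) \<bullet> x = - (t / 2) * (norm x)\<^sup>2" .
    have square: "(norm (d + t *\<^sub>R x))\<^sup>2 = (norm d)\<^sup>2 + 2 * t * (d \<bullet> x) + t\<^sup>2 * (norm x)\<^sup>2" for d
      unfolding power2_norm_eq_inner
      by (simp add: inner_add_left inner_add_right inner_commute[of x d] power2_eq_square distrib_left)
    have "q t u - q t v = (p u - p v) + t *\<^sub>R x"
      by (simp add: q_def x_def scaleR_diff_right)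
    then have "(dist (q t u) (q t v))\<^sup>2 = (dist (p u) (p v))\<^sup>2 + 2 * t * ((p u - p v) \<bullet> x) + t\<^sup>2 * (norm x)\<^sup>2"
      unfolding dist_norm square[symmetric] by (simp only:)
    also have "\<dots> = (dist (p u) (p v))\<^sup>2"
      unfolding px by (simp add: power2_eq_square)
    finally show ?thesis by (simp add: power2_eq_iff_nonneg)
  qed
  have E_len: "dist (q t u) (q t v) = dist (p u) (p v)"
    if t: "t \<in> {0..\<tau>}" and ind: "independent_family V F (rigidity_row (mid t))" and e: "{u, v} \<in> edges G" for t u v
  proof (cases "(u, v) \<in> F")
    case True
    then show ?thesis using F_len t by blast
  next
    case False
    let ?e = "(u, v)" and ?F' = "insert (u, v) F"
    have eE: "?e \<in> E" using e by (simp add: E_def)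
    \<comment> \<open>Maximality of \<open>F\<close> gives dependence at the generic
      \<open>p\<close>, hence at every placement, in particular at \<open>mid t\<close>, which is
      not known to be generic.\<close>
    have "\<not> independent_family V ?F' (rigidity_row p)"
      using F_max[of ?F'] F False eE by auto
    then have "\<not> independent_family V ?F' (rigidity_row (mid t))"
      using generic_independent_family[OF _ polynomial_family_rigidity_row _ gen[folded V_def], of ?F' V "mid t"]
        finF FV eE EV by auto
    then obtain c where c: "\<And>x. x \<in> V \<Longrightarrow> (\<Sum>j\<in>?F'. c j *\<^sub>R rigidity_row (mid t) j x) = 0"
      and c_ne: "\<exists>j\<in>?F'. c j \<noteq> 0"
      unfolding independent_family_def by blast
    have c_e: "c ?e \<noteq> 0"
    proof
      assume "c ?e = 0"
      then have "\<forall>x\<in>V. (\<Sum>j\<in>F. c j *\<^sub>R rigidity_row (mid t) j x) = 0"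
        using c finF False by simp
      then have "\<forall>j\<in>F. c j = 0" using ind unfolding independent_family_def by blast
      then show False using c_ne \<open>c ?e = 0\<close> by auto
    qed
    \<comment> \<open>The rows of \<open>F\<close> at \<open>mid t\<close> annihilate this
      displacement. As \<open>c ?e\<close> is nonzero, the dependency forces the same for the row of
      \<open>?e\<close>.\<close>
    define f where "f v = q t v - p v" for v
    have row: "(\<Sum>x\<in>V. rigidity_row (mid t) j x \<bullet> f x) =
        (mid t (fst j) - mid t (snd j)) \<bullet> (f (fst j) - f (snd j))" if "j \<in> ?F'" for j
      using rigidity_row_inner[OF finV, of "fst j" "snd j" "mid t" f] that FV eE EV by auto
    have "0 = (\<Sum>x\<in>V. (\<Sum>j\<in>?F'. c j *\<^sub>R rigidity_row (mid t) j x) \<bullet> f x)"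
      using c by simp
    also have "\<dots> = (\<Sum>j\<in>?F'. c j * (\<Sum>x\<in>V. rigidity_row (mid t) j x \<bullet> f x))"
      unfolding inner_sum_left sum_distrib_left by (subst sum.swap) simp
    also have "\<dots> = (\<Sum>j\<in>?F'. c j * ((mid t (fst j) - mid t (snd j)) \<bullet> (f (fst j) - f (snd j))))"
      by (intro sum.cong refl arg_cong2[where f = "(*)"] row)
    also have "\<dots> = c ?e * ((mid t u - mid t v) \<bullet> (f u - f v)) +
        (\<Sum>j\<in>F. c j * ((mid t (fst j) - mid t (snd j)) \<bullet> (f (fst j) - f (snd j))))"
      using False finF by simp
    also have "(\<Sum>j\<in>F. c j * ((mid t (fst j) - mid t (snd j)) \<bullet> (f (fst j) - f (snd j)))) = 0"
      using mid_eq F_len[OF t] by (intro sum.neutral) (auto simp: f_def)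
    finally show ?thesis using c_e mid_eq[of t u v] by (simp add: f_def)
  qed
  have "\<forall>\<^sub>F t in at_right 0. independent_family V F (rigidity_row (mid t))"
    by (rule eventually_independent_family[OF finF polynomial_family_rigidity_row[OF FV]])
      (use F mid_lim in auto)
  then obtain a where a: "a > 0" "\<And>t. 0 < t \<Longrightarrow> t < a \<Longrightarrow> independent_family V F (rigidity_row (mid t))"
    unfolding eventually_at_right_field by blast
  \<comment> \<open>Halving \<open>a\<close> keeps the rescaled time, apart from its start, strictly
    inside the range where the rows of \<open>F\<close> are independent at
    \<open>mid t\<close>.\<close>
  define \<tau>' where "\<tau>' = min \<tau> (a / 2)"
  have \<tau>': "\<tau>' > 0" "\<tau>' \<le> \<tau>" "\<tau>' < a" using \<tau> a(1) by (auto simp: \<tau>'_def)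
  have scale: "\<tau>' * t \<in> {0..\<tau>}" if "t \<in> {0..1}" for t
    using that \<tau>' mult_left_le[of t \<tau>'] by (simp, linarith)
  have "motion G p (\<lambda>t. q (\<tau>' * t))"
    unfolding motion_def
  proof (intro conjI ballI allI impI)
    fix v
    show "continuous_on {0..1} (\<lambda>t. q (\<tau>' * t) v)"
      by (rule continuous_on_compose2[OF q_cont]) (use scale in \<open>auto intro!: continuous_intros\<close>)
    show "q (\<tau>' * 0) v = p v" by (simp add: q_def)
  next
    fix t :: real and u v assume t: "t \<in> {0..1}" and e: "{u, v} \<in> edges G"
    show "dist (q (\<tau>' * t) u) (q (\<tau>' * t) v) = dist (p u) (p v)"
    proof (cases "t = 0")
      case True
      then show ?thesis by (simp add: q_def)
    next
      case False
      then have "0 < \<tau>' * t" "\<tau>' * t < a"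
        using t \<tau>' mult_left_le[of t \<tau>'] by (simp, simp, linarith)
      then show ?thesis using E_len[OF scale[OF t] a(2) e] by blast
    qed
  qed
  then have all_len: "dist (q (\<tau>' * t) u0) (q (\<tau>' * t) v0) = dist (p u0) (p v0)" if "t \<in> {0..1}" for t
    using rig uv that unfolding rigid_framework_def by blast
  \<comment> \<open>By averaging, the preserved distance is an orthogonality to
    \<open>t *\<^sub>R (y t u0 - y t v0)\<close>. Dividing by \<open>t\<close> before it tends to 0
    recovers the velocity \<open>w\<close>.\<close>
  have "(mid t u0 - mid t v0) \<bullet> (y t u0 - y t v0) = 0" if t: "0 < t" "t < \<tau>'" for t
  proof -
    have "dist (q t u0) (q t v0) = dist (p u0) (p v0)"
      using all_len[of "t / \<tau>'"] t by simp
    then have "(mid t u0 - mid t v0) \<bullet> (t *\<^sub>R (y t u0 - y t v0)) = 0"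
      using mid_eq[of t u0 v0] by (simp add: q_def scaleR_diff_right)
    then show ?thesis using t by simp
  qed
  then have "\<forall>\<^sub>F t in at_right 0. (mid t u0 - mid t v0) \<bullet> (y t u0 - y t v0) = 0"
    using \<tau>'(1) unfolding eventually_at_right_field by blast
  then have "((\<lambda>t. (mid t u0 - mid t v0) \<bullet> (y t u0 - y t v0)) \<longlongrightarrow> 0) (at_right 0)"
    by (rule tendsto_eventually)
  moreover have "((\<lambda>t. (mid t u0 - mid t v0) \<bullet> (y t u0 - y t v0)) \<longlongrightarrow> (p u0 - p v0) \<bullet> (w u0 - w v0)) (at_right 0)"
    by (intro tendsto_intros mid_lim y_lim)
  ultimately show ?thesis
    using tendsto_unique[OF trivial_limit_at_right_real] by blast
qed

section \<open>Generic points: general position and complete frameworks\<close>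

lemma independent_family_unit:
  "independent_family {()} J (\<lambda>j _. x j) \<longleftrightarrow> (\<forall>c. (\<Sum>j\<in>J. c j *\<^sub>R x j) = 0 \<longrightarrow> (\<forall>j\<in>J. c j = 0))"
  by (simp add: independent_family_def)

lemma axis_family_independent:
  assumes "finite J" "inj_on h J" "(\<Sum>j\<in>J. c j *\<^sub>R axis (h j) 1) = (0 :: real ^ 'n)" "i \<in> J"
  shows "c i = 0"
proof -
  have "0 = (\<Sum>j\<in>J. c j *\<^sub>R axis (h j) 1 :: real ^ 'n) $ h i" using assms(3) by simp
  also have "\<dots> = (\<Sum>j\<in>J. if j = i then c j else 0)"
    unfolding sum_component
    by (rule sum.cong) (use assms(2,4) in \<open>auto simp: axis_def dest: inj_onD\<close>)
  also have "\<dots> = c i" using assms(1,4) by simp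
  finally show ?thesis by simp
qed

context
  fixes V J :: "'v set" and p :: "'v \<Rightarrow> real ^ 'n"
  assumes gen: "generic V p" and finV: "finite V" and J: "J \<subseteq> V" "card J = CARD('n)"
begin

text \<open>One independent placement is enough; it puts the points of \<open>J\<close> at the
  standard basis vectors.\<close>

lemma generic_vectors_independent: "independent_family {()} J (\<lambda>j _. p j)"
proof -
  have finJ: "finite J" using finV J(1) finite_subset by blast
  obtain h where h: "bij_betw h J (UNIV :: 'n set)"
    using finite_same_card_bij[OF finJ, of "UNIV :: 'n set"] J(2) by auto
  have "polynomial_family V {()} J (\<lambda>p j _. p j :: real ^ 'n)"
    unfolding polynomial_family_def
  proof (intro ballI allI)
    fix j w and k :: 'n assume "j \<in> J"
    then have "polyfun (V \<times> UNIV) (\<lambda>x. x (j, k))" using J(1) by (intro polyfun_var) auto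
    then show "\<exists>F. polyfun (V \<times> UNIV) F \<and> (\<forall>p. p j $ k = F (coords p))"
      by (intro exI[of _ "\<lambda>x. x (j, k)"]) (simp add: coords_def)
  qed
  from generic_independent_family[OF finJ this _ gen, of "\<lambda>j. axis (h j) 1"]
  show ?thesis
    unfolding independent_family_unit
    using axis_family_independent[OF finJ bij_betw_imp_inj_on[OF h]] by blast
qed

lemma generic_differences_independent:
  assumes i: "i \<in> V - J"
  shows "independent_family {()} J (\<lambda>j _. p i - p j)"
proof -
  have finJ: "finite J" using finV J(1) finite_subset by blast
  obtain h where h: "bij_betw h J (UNIV :: 'n set)"
    using finite_same_card_bij[OF finJ, of "UNIV :: 'n set"] J(2) by auto
  have pf: "polynomial_family V {()} J (\<lambda>p j _. p i - p j :: real ^ 'n)"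
    unfolding polynomial_family_def
  proof (intro ballI allI)
    fix j w and k :: 'n assume "j \<in> J"
    then have "polyfun (V \<times> UNIV) (\<lambda>x. x (i, k) - x (j, k))"
      using J(1) i by (intro polyfun_var polyfun_diff) auto
    then show "\<exists>F. polyfun (V \<times> UNIV) F \<and> (\<forall>p. (p i - p j) $ k = F (coords p))"
      by (intro exI[of _ "\<lambda>x. x (i, k) - x (j, k)"]) (simp add: coords_def)
  qed
  \<comment> \<open>With \<open>i\<close> at the origin, the sign makes the differences
    \<open>p0 i - p0 j\<close> the standard basis.\<close>
  define p0 :: "'v \<Rightarrow> real ^ 'n" where "p0 j = (if j = i then 0 else axis (h j) (- 1))" for j
  have "independent_family {()} J (\<lambda>j _. p0 i - p0 j)"
    unfolding independent_family_unit
  proof (intro allI impI ballI)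
    fix c j assume c: "(\<Sum>j\<in>J. c j *\<^sub>R (p0 i - p0 j)) = 0" and j: "j \<in> J"
    have "(\<Sum>j\<in>J. c j *\<^sub>R (p0 i - p0 j)) = (\<Sum>j\<in>J. c j *\<^sub>R axis (h j) 1)"
      by (rule sum.cong) (use i in \<open>auto simp: p0_def vec_eq_iff axis_def\<close>)
    then show "c j = 0"
      using axis_family_independent[OF finJ bij_betw_imp_inj_on[OF h], of c j] c j by simp
  qed
  from generic_independent_family[OF finJ pf this gen] show ?thesis .
qed

lemma generic_vectors_orthogonal:
  assumes "\<And>j. j \<in> J \<Longrightarrow> h \<bullet> p j = 0"
  shows "h = 0"
  using generic_vectors_independent finite_subset[OF J(1) finV]
  unfolding independent_family_unit
  by (intro independent_family_orthogonal[of J p h]) (use J(2) assms in auto)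

lemma generic_differences_orthogonal:
  assumes "i \<in> V - J" "\<And>j. j \<in> J \<Longrightarrow> h \<bullet> (p i - p j) = 0"
  shows "h = 0"
  using generic_differences_independent[OF assms(1)] finite_subset[OF J(1) finV]
  unfolding independent_family_unit
  by (intro independent_family_orthogonal[of J "\<lambda>j. p i - p j" h]) (use J(2) assms in auto)

lemma generic_dual_vectors: "\<exists>s. \<forall>i\<in>J. \<forall>j\<in>J. p i \<bullet> s j = of_bool (i = j)"
proof -
  have "\<exists>s. \<forall>i\<in>J. \<forall>j\<in>J. (\<Sum>v\<in>{()}. p i \<bullet> s j v) = of_bool (i = j)"
    by (rule dual_family)
      (use generic_vectors_independent finite_subset[OF J(1) finV] in \<open>auto simp: independent_family_def\<close>)
  then obtain s where "\<forall>i\<in>J. \<forall>j\<in>J. (\<Sum>v\<in>{()}. p i \<bullet> s j v) = of_bool (i = j)" by blast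
  then show ?thesis by (intro exI[of _ "\<lambda>j. s j ()"]) simp
qed

text \<open>A normal of the affine hyperplane through the points of \<open>J\<close>. Their linear
  independence keeps this hyperplane off the origin, which permits the scaling to 1; the sum of the
  dual vectors is such a normal.\<close>

lemma generic_affine_normal: "\<exists>h. h \<noteq> 0 \<and> (\<forall>j\<in>J. p j \<bullet> h = 1)"
proof -
  obtain s where s: "\<And>i j. i \<in> J \<Longrightarrow> j \<in> J \<Longrightarrow> p i \<bullet> s j = of_bool (i = j)"
    using generic_dual_vectors by blast
  have finJ: "finite J" using finV J(1) finite_subset by blast
  define h where "h = (\<Sum>j\<in>J. s j)"
  have h: "p i \<bullet> h = 1" if "i \<in> J" for i
  proof -
    have "p i \<bullet> h = (\<Sum>j\<in>J. if j = i then 1 else 0)"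
      unfolding h_def inner_sum_right by (rule sum.cong) (use s that in auto)
    then show ?thesis using that finJ by simp
  qed
  have "J \<noteq> {}" using J(2) by auto
  then have "h \<noteq> 0" using h by fastforce
  then show ?thesis using h by blast
qed

text \<open>The origin serves as an additional vertex, which with \<open>J\<close> spans the space affinely. The
  motion extends to it, with velocity \<open>f0\<close>.\<close>

lemma generic_complete_infinitesimal_motion_trivial:
  assumes w: "\<And>u v. u \<in> V \<Longrightarrow> v \<in> V \<Longrightarrow> (p u - p v) \<bullet> (w u - w v) = 0"
  shows "trivial_motion V p w"
proof -
  obtain s where s: "\<And>i j. i \<in> J \<Longrightarrow> j \<in> J \<Longrightarrow> p i \<bullet> s j = of_bool (i = j)"
    using generic_dual_vectors by blast
  have finJ: "finite J" using finV J(1) finite_subset by blast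
  have dual: "(\<Sum>j\<in>J. (p i \<bullet> s j) *\<^sub>R x j) = x i" if "i \<in> J" for i and x :: "'v \<Rightarrow> real ^ 'n"
  proof -
    have "(\<Sum>j\<in>J. (p i \<bullet> s j) *\<^sub>R x j) = (\<Sum>j\<in>J. if j = i then x j else 0)"
      by (rule sum.cong) (use s that in auto)
    then show ?thesis using that finJ by simp
  qed
  have dual': "(\<Sum>j\<in>J. a j * (p i \<bullet> s j)) = a i" if "i \<in> J" for i a
  proof -
    have "(\<Sum>j\<in>J. a j * (p i \<bullet> s j)) = (\<Sum>j\<in>J. if j = i then a j else 0)"
      by (rule sum.cong) (use s that in auto)
    then show ?thesis using that finJ by simp
  qed
  have expand_s: "x = (\<Sum>i\<in>J. (x \<bullet> p i) *\<^sub>R s i)" for x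
  proof -
    have "x - (\<Sum>i\<in>J. (x \<bullet> p i) *\<^sub>R s i) = 0"
      by (rule generic_vectors_orthogonal)
        (simp add: inner_diff_left inner_sum_left inner_commute[of "s _"] dual')
    then show ?thesis by simp
  qed
  have expand: "x = (\<Sum>i\<in>J. (x \<bullet> s i) *\<^sub>R p i)" for x
  proof -
    define h where "h = x - (\<Sum>i\<in>J. (x \<bullet> s i) *\<^sub>R p i)"
    have hs: "h \<bullet> s j = 0" if "j \<in> J" for j
    proof -
      have "(\<Sum>i\<in>J. (x \<bullet> s i) * (p i \<bullet> s j)) = (\<Sum>i\<in>J. if i = j then x \<bullet> s i else 0)"
        by (rule sum.cong) (use s that in auto)
      then show ?thesis using that finJ by (simp add: h_def inner_diff_left inner_sum_left)
    qed
    have "h \<bullet> h = h \<bullet> (\<Sum>i\<in>J. (h \<bullet> p i) *\<^sub>R s i)" using expand_s[of h] by simp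
    also have "\<dots> = 0" using hs by (simp add: inner_sum_right)
    finally show ?thesis by (simp add: h_def)
  qed
  \<comment> \<open>Chosen with \<open>f0 \<bullet> p i = w i \<bullet> p i\<close> on
    \<open>J\<close>: the distances between the points of \<open>J\<close> and the added vertex at
    the origin are preserved to first order.\<close>
  define f0 where "f0 = (\<Sum>i\<in>J. (w i \<bullet> p i) *\<^sub>R s i)"
  define g where "g i = w i - f0" for i
  have gg: "g i \<bullet> p i = 0" if "i \<in> J" for i
    using dual'[OF that, of "\<lambda>i. w i \<bullet> p i"]
    by (simp add: g_def f0_def inner_diff_left inner_sum_left inner_commute[of "s _"])
  have gij: "g i \<bullet> p j = - (g j \<bullet> p i)" if "i \<in> J" "j \<in> J" for i j
  proof -
    have "(p i - p j) \<bullet> (g i - g j) = 0" using w[of i j] that J(1) by (auto simp: g_def)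
    then show ?thesis
      using gg that by (simp add: inner_diff_left inner_diff_right inner_commute[of "p _"])
  qed
  \<comment> \<open>The linear map with \<open>A (p i) = g i\<close>, written through the dual
    basis. Its skewness is the antisymmetry \<open>gij\<close> on a basis.\<close>
  define A where "A x = (\<Sum>i\<in>J. (x \<bullet> s i) *\<^sub>R g i)" for x
  have linA: "linear A"
    unfolding A_def
    by (rule linearI) (simp_all add: inner_add_left scaleR_add_left sum.distrib scaleR_sum_right)
  have Ap: "A (p i) = g i" if "i \<in> J" for i
    unfolding A_def using dual[OF that] .
  have skewA: "A x \<bullet> x = 0" for x
  proof -
    define S where "S = (\<Sum>i\<in>J. \<Sum>j\<in>J. (x \<bullet> s i) * (x \<bullet> s j) * (g i \<bullet> p j))"
    have "A x \<bullet> p j = (\<Sum>i\<in>J. (x \<bullet> s i) * (g i \<bullet> p j))" for j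
      by (simp add: A_def inner_sum_left)
    then have "A x \<bullet> (\<Sum>j\<in>J. (x \<bullet> s j) *\<^sub>R p j) = (\<Sum>j\<in>J. \<Sum>i\<in>J. (x \<bullet> s i) * (x \<bullet> s j) * (g i \<bullet> p j))"
      by (simp add: inner_sum_right sum_distrib_left mult_ac)
    also have "\<dots> = S" unfolding S_def by (rule sum.swap)
    finally have "A x \<bullet> x = S" unfolding expand[of x, symmetric] .
    moreover have "S = - S"
    proof -
      have "S = (\<Sum>i\<in>J. \<Sum>j\<in>J. - ((x \<bullet> s j) * (x \<bullet> s i) * (g j \<bullet> p i)))"
        unfolding S_def by (intro sum.cong refl, subst gij) (simp_all add: mult_ac)
      also have "\<dots> = - S" unfolding S_def sum_negf by (subst sum.swap) simp
      finally show ?thesis .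
    qed
    ultimately show ?thesis by simp
  qed
  have "w v = A (p v) + f0" if v: "v \<in> V" for v
  proof (cases "v \<in> J")
    case True
    then show ?thesis by (simp add: Ap g_def)
  next
    case False
    \<comment> \<open>The discrepancy at \<open>v\<close> is orthogonal to all differences
      \<open>p v - p j\<close>, because \<open>w\<close> and the skew map \<open>A\<close> both
      preserve these lengths to first order. There are as many such independent differences as
      dimensions.\<close>
    have "w v - f0 - A (p v) = 0"
    proof (rule generic_differences_orthogonal)
      show "v \<in> V - J" using v False by simp
      fix j assume j: "j \<in> J"
      have eq: "w v - f0 - A (p v) = (w v - w j) - A (p v - p j)"
        by (simp add: linear_diff[OF linA] Ap[OF j] g_def)
      have "(w v - w j) \<bullet> (p v - p j) = 0"
        using w[of v j] j v J(1) by (subst inner_commute) blast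
      then show "(w v - f0 - A (p v)) \<bullet> (p v - p j) = 0"
        unfolding eq by (subst inner_diff_left) (simp add: skewA)
    qed
    then show ?thesis by (simp add: algebra_simps)
  qed
  moreover have "skew (matrix A)"
    by (simp add: skew_def matrix_works[OF iffD2[OF linear_matrix_vector_mul_eq linA]] skewA)
  ultimately show ?thesis
    unfolding trivial_motion_def
    by (intro exI[of _ "matrix A"] exI[of _ f0]) (simp add: matrix_works[OF iffD2[OF linear_matrix_vector_mul_eq linA]])
qed

end

lemma generic_rigid_imp_infinitesimally_rigid:
  fixes p :: "'a \<Rightarrow> real ^ 'n"
  assumes "graph_on_verts G" "generic (verts G) p" "rigid_framework G p"
    and "card (verts G) \<ge> CARD('n)" and "infinitesimal_motion G p w"
  shows "trivial_motion (verts G) p w"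
proof -
  obtain J where "J \<subseteq> verts G" "card J = CARD('n)"
    using obtain_subset_with_card_n[OF assms(4)] .
  then show ?thesis
    using assms(1) generic_rigid_infinitesimal_motion[OF assms(1-3,5)]
    by (intro generic_complete_infinitesimal_motion_trivial[OF assms(2)])
      (auto simp: graph_on_verts_def)
qed

section \<open>Avoiding exceptional positions and directions\<close>

lemma generic_dense:
  fixes a :: "'v \<Rightarrow> real ^ 'n"
  assumes "finite V" "\<eta> > 0"
  shows "\<exists>q. generic V q \<and> (\<forall>v\<in>V. dist (q v) (a v) < \<eta>)"
proof -
  \<comment> \<open>The norm is at most the sum of the coordinate errors, so each coordinate gets an
    equal share of \<open>\<eta>\<close>.\<close>
  have "\<eta> / CARD('n) > 0" using assms(2) by simp
  moreover have "finite (V \<times> (UNIV :: 'n set))" using assms(1) by simp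
  ultimately obtain x where x: "algebraically_independent (V \<times> UNIV) x"
    "\<forall>i\<in>V \<times> (UNIV :: 'n set). \<bar>x i - coords a i\<bar> < \<eta> / CARD('n)"
    using algebraically_independent_dense[of "V \<times> UNIV" "\<eta> / CARD('n)" "coords a"] by blast
  define q :: "'v \<Rightarrow> real ^ 'n" where "q v = (\<chi> k. x (v, k))" for v
  have "(\<lambda>(v, k). q v $ k) = x" by (auto simp: q_def)
  then have "generic V q" using x(1) by (simp add: generic_def)
  moreover have "dist (q v) (a v) < \<eta>" if v: "v \<in> V" for v
  proof -
    have "dist (q v) (a v) \<le> (\<Sum>k\<in>UNIV. \<bar>(q v - a v) $ k\<bar>)"
      unfolding dist_norm by (rule norm_le_l1_cart)
    also have "\<dots> < (\<Sum>k\<in>(UNIV :: 'n set). \<eta> / CARD('n))"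
      by (rule sum_strict_mono) (use x(2) v in \<open>auto simp: q_def coords_def\<close>)
    also have "\<dots> = \<eta>" by simp
    finally show ?thesis .
  qed
  ultimately show ?thesis by blast
qed

text \<open>Finitely many hyperplanes are negligible and cannot cover the space.\<close>

lemma exists_nonorthogonal:
  fixes H :: "'b::euclidean_space set"
  assumes "finite H" "0 \<notin> H"
  shows "\<exists>y. \<forall>h\<in>H. h \<bullet> y \<noteq> 0"
proof -
  have "negligible (\<Union>h\<in>H. {y. h \<bullet> y = 0})"
    using assms by (intro negligible_Union) (auto intro!: negligible_hyperplane)
  then have "(\<Union>h\<in>H. {y. h \<bullet> y = 0}) \<noteq> UNIV" using non_negligible_UNIV by metis
  then show ?thesis by blast
qed

lemma linked_invariant:
  assumes "linked H u v" and step: "\<And>x y. {x, y} \<in> edges H \<Longrightarrow> g x = g y"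
  shows "g u = g v"
proof -
  have "g (hd xs) = g (last xs)" if "xs \<noteq> []" "successively (\<lambda>x y. {x, y} \<in> edges H) xs" for xs
    using that
  proof (induction xs rule: induct_list012)
    case (3 x y zs)
    then show ?case using step[of x y] by auto
  qed auto
  then show ?thesis using assms(1) unfolding linked_def path_between_def by blast
qed

section \<open>Rigid partitions\<close>

theorem theorem7p6:
  fixes G :: "'a graph" and m d :: nat and P :: "nat \<Rightarrow> 'a set"
  assumes "finite_graph G"
    and "d = CARD('n::finite)" and "m \<ge> d" and "d \<ge> 1"
    and "\<And>i. i \<in> {1..m} \<Longrightarrow> P i \<noteq> {}"
    and "disjoint_family_on P {1..m}"
    and "(\<Union>i\<in>{1..m}. P i) = verts G"
    and "d_rigid TYPE('n) (reduced_graph G m P)"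
    and "\<And>i. i \<in> {1..m} \<Longrightarrow> connected_graph (Q_graph d G m P i)"
  shows "d_rigid TYPE('n) G"
proof -
  define V where "V = verts G"
  have finV: "finite V" using assms(1) by (simp add: finite_graph_def V_def)
  have edge: "u \<in> V \<and> v \<in> V \<and> u \<noteq> v" if "{u, v} \<in> edges G" for u v
    using assms(1) that by (fastforce simp: finite_graph_def V_def)
  have G: "graph_on_verts G"
    using finV edge by (auto simp: graph_on_verts_def V_def)
  define idx where "idx v = (SOME i. i \<in> {1..m} \<and> v \<in> P i)" for v
  have idx: "idx v \<in> {1..m}" "v \<in> P (idx v)" if "v \<in> V" for v
  proof -
    have "\<exists>i. i \<in> {1..m} \<and> v \<in> P i" using that unfolding V_def assms(7)[symmetric] by blast
    then show "idx v \<in> {1..m}" "v \<in> P (idx v)" unfolding idx_def by (metis (mono_tags, lifting) someI_ex)+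
  qed
  have PV: "v \<in> V" if "i \<in> {1..m}" "v \<in> P i" for i v
    using that unfolding V_def assms(7)[symmetric] by blast
  have idx_eq: "idx v = i" if "i \<in> {1..m}" "v \<in> P i" for i v
    using idx[OF PV[OF that]] that assms(6) unfolding disjoint_family_on_def by blast
  let ?R = "reduced_graph G m P"
  have VR: "verts ?R = {1..m}" by (simp add: reduced_graph_def)
  obtain p :: "nat \<Rightarrow> real ^ 'n" where p: "generic {1..m} p" "rigid_framework ?R p"
    using assms(8) unfolding d_rigid_def VR by blast
  have R: "graph_on_verts ?R"
    by (auto simp: graph_on_verts_def reduced_graph_def doubleton_eq_iff)
  \<comment> \<open>Here \<open>m \<ge> d\<close> enters: the reduced graph has enough vertices for
    length-preserving velocities of the generic \<open>p\<close> to be trivial motions.\<close>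
  have R_trivial: "trivial_motion {1..m} p w" if "infinitesimal_motion ?R p w" for w
    using generic_rigid_imp_infinitesimally_rigid[OF R _ p(2) _ that] p(1) assms(2,3) by (simp add: VR)

  \<comment> \<open>The index sets that can witness an edge of some \<open>Q_i\<close>. As they are
    finitely many, a single \<open>y\<close> can be non-parallel to the affine span of the
    \<open>p j\<close>, \<open>j \<in> J\<close>, for all of them.\<close>
  define \<J> where "\<J> = {J. J \<subseteq> {1..m} \<and> card J = CARD('n)}"
  have "\<forall>J\<in>\<J>. \<exists>h. h \<noteq> 0 \<and> (\<forall>j\<in>J. p j \<bullet> h = 1)"
    by (auto simp: \<J>_def intro!: generic_affine_normal[OF p(1)])
  then obtain n where n: "\<And>J. J \<in> \<J> \<Longrightarrow> n J \<noteq> 0" "\<And>J j. J \<in> \<J> \<Longrightarrow> j \<in> J \<Longrightarrow> p j \<bullet> n J = 1"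
    by metis
  have "finite (n ` \<J>)" by (simp add: \<J>_def)
  moreover have "0 \<notin> n ` \<J>" using n(1) by force
  ultimately obtain y where y: "\<And>J. J \<in> \<J> \<Longrightarrow> n J \<bullet> y \<noteq> 0"
    using exists_nonorthogonal[of "n ` \<J>"] by blast

  \<comment> \<open>For an inner edge both \<open>D u v\<close> and \<open>D v u\<close> are
    \<open>y\<close> rather than opposite vectors; orthogonality does not see the sign.\<close>
  define D where "D u v = (if idx u = idx v then y else p (idx u) - p (idx v))" for u v
  define P0 where "P0 v = p (idx v)" for v
  have limit_rigid: "trivial_motion (verts G) P0 f"
    if f: "\<forall>u v. {u, v} \<in> edges G \<longrightarrow> D u v \<bullet> (f u - f v) = 0" for f
  proof -
    have Q_edge: "f u = f v" if i: "i \<in> {1..m}" and e: "{u, v} \<in> edges (Q_graph d G m P i)" for i u v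
    proof -
      obtain u' v' J where *: "{u, v} = {u', v'}" "J \<subseteq> {1..m}" "card J = d"
        "\<And>j. j \<in> J \<Longrightarrow> linked (between G (P i) (P j)) u' v'"
        using e by (auto simp: Q_graph_def)
      have J: "J \<in> \<J>" using * assms(2) by (simp add: \<J>_def)
      define dir where "dir j = (if j = i then y else p i - p j)" for j
      have step: "dir j \<bullet> f a = dir j \<bullet> f b"
        if j: "j \<in> J" and ab: "{a, b} \<in> edges (between G (P i) (P j))" for j a b
      proof -
        have jm: "j \<in> {1..m}" using j *(2) by blast
        have E: "{a, b} \<in> edges G" and *: "{a, b} \<inter> P i \<noteq> {}" "{a, b} \<inter> P j \<noteq> {}" "{a, b} \<subseteq> P i \<union> P j"
          using ab by (auto simp: between_def)
        have D: "D a b \<bullet> (f a - f b) = 0" using f E by blast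
        \<comment> \<open>An edge of \<open>G[V_i,V_j]\<close> has one end in each of the two parts,
          also when they coincide, so up to sign its direction depends only on \<open>i\<close> and
          \<open>j\<close>.\<close>
        have "(a \<in> P i \<and> b \<in> P j) \<or> (a \<in> P j \<and> b \<in> P i)" using * by blast
        then have "D a b = dir j \<or> D a b = - dir j"
          using idx_eq[OF i] idx_eq[OF jm] by (auto simp: D_def dir_def)
        then have "dir j \<bullet> (f a - f b) = 0" using D by auto
        then show ?thesis by (simp add: inner_diff_right)
      qed
      define h where "h = f u' - f v'"
      have dir: "dir j \<bullet> h = 0" if "j \<in> J" for j
        using linked_invariant[OF *(4)[OF that], of "\<lambda>a. dir j \<bullet> f a"] step[OF that]
        by (simp add: h_def inner_diff_right)
      note gen = p(1) finite_atLeastAtMost *(2) *(3)[unfolded assms(2)]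
      have "h = 0"
      proof (cases "i \<in> J")
        case False
        show ?thesis
        proof (rule generic_differences_orthogonal[OF gen])
          show "i \<in> {1..m} - J" using False i by blast
          fix j assume "j \<in> J"
          then have "j \<noteq> i" "dir j \<bullet> h = 0" using False dir by auto
          then show "h \<bullet> (p i - p j) = 0" by (simp add: dir_def inner_commute)
        qed
      next
        \<comment> \<open>Orthogonality to the remaining \<open>d - 1\<close> differences gives
          \<open>h\<close> the same product \<open>k\<close> with all \<open>p j\<close>, so
          \<open>h\<close> is a multiple of the normal \<open>n J\<close>. Orthogonality to
          \<open>y\<close> leaves only the zero multiple.\<close>
        case True
        define k where "k = h \<bullet> p i"
        have hp: "h \<bullet> p j = k" if "j \<in> J" for j
          using dir[OF that] by (cases "j = i") (auto simp: dir_def k_def inner_diff_left inner_commute[of h])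
        have "h - k *\<^sub>R n J = 0"
          by (rule generic_vectors_orthogonal[OF gen])
            (simp add: inner_diff_left hp inner_commute[of "n J"] n(2)[OF J])
        then have h: "h = k *\<^sub>R n J" by simp
        moreover have "y \<bullet> h = 0" using dir[OF True] by (simp add: dir_def)
        ultimately have "k = 0" using y[OF J] by (simp add: inner_commute[of y])
        then show ?thesis using h by simp
      qed
      then show ?thesis using *(1) by (auto simp: h_def doubleton_eq_iff)
    qed
    have f_const: "f u = f v" if "i \<in> {1..m}" "u \<in> P i" "v \<in> P i" for i u v
      using assms(9)[OF that(1)] that linked_invariant[of "Q_graph d G m P i" u v f] Q_edge[OF that(1)]
      by (auto simp: connected_graph_def Q_graph_def)
    define f' where "f' i = f (SOME v. v \<in> P i)" for i
    have f': "f v = f' (idx v)" if "v \<in> V" for v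
    proof -
      have "(SOME v. v \<in> P (idx v')) \<in> P (idx v')" if "v' \<in> V" for v'
        using idx(2)[OF that] by (rule someI)
      then show ?thesis
        unfolding f'_def using that idx[OF that] by (intro f_const[of "idx v"])
    qed
    \<comment> \<open>Every edge of the reduced graph comes from an edge of \<open>G\<close> between
      the two parts, and the direction prescribed there is the reduced edge vector up to
      sign.\<close>
    have "infinitesimal_motion ?R p f'"
      unfolding infinitesimal_motion_def
    proof (intro allI impI)
      fix i j assume "{i, j} \<in> edges ?R"
      then obtain i' j' u v where *: "{i, j} = {i', j'}" "i' \<in> {1..m}" "j' \<in> {1..m}" "i' \<noteq> j'"
        "u \<in> P i'" "v \<in> P j'" "{u, v} \<in> edges G"
        by (auto simp: reduced_graph_def)
      have "idx u = i'" "idx v = j'" using * idx_eq by auto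
      moreover have "D u v \<bullet> (f u - f v) = 0" using f *(7) by blast
      ultimately have "(p i' - p j') \<bullet> (f' i' - f' j') = 0"
        using *(4) f' edge[OF *(7)] by (simp add: D_def)
      moreover have "i = i' \<and> j = j' \<or> i = j' \<and> j = i'" using *(1) by (simp add: doubleton_eq_iff)
      ultimately show "(p i - p j) \<bullet> (f' i - f' j) = 0"
        by (auto simp: inner_diff_left inner_diff_right)
    qed
    then obtain M b where "skew M" "\<And>i. i \<in> {1..m} \<Longrightarrow> f' i = M *v p i + b"
      using R_trivial unfolding trivial_motion_def by blast
    then have "skew M \<and> (\<forall>v\<in>V. f v = M *v P0 v + b)"
      using f' idx(1) by (simp add: P0_def)
    then show ?thesis unfolding trivial_motion_def V_def by blast
  qed
  have "\<exists>\<delta>>0. \<forall>q c f. (\<forall>v\<in>verts G. dist (q v) (P0 v) < \<delta>) \<longrightarrow>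
    (\<forall>u v. {u, v} \<in> edges G \<longrightarrow> dist (c u v *\<^sub>R (q u - q v)) (D u v) < \<delta>) \<longrightarrow>
    infinitesimal_motion G q f \<longrightarrow> trivial_motion (verts G) q f"
    by (rule trivial_motions_nearby[OF G limit_rigid])
  then obtain \<delta> where "\<delta> > 0" and \<delta>: "\<And>q c f. \<lbrakk>\<forall>v\<in>V. dist (q v) (P0 v) < \<delta>;
      \<forall>u v. {u, v} \<in> edges G \<longrightarrow> dist (c u v *\<^sub>R (q u - q v)) (D u v) < \<delta>;
      infinitesimal_motion G q f\<rbrakk> \<Longrightarrow> trivial_motion V q f"
    unfolding V_def by blast

  \<comment> \<open>An injective numbering puts the vertices of a part at distinct multiples of
    \<open>y\<close>, so that each inner edge vector can be rescaled to \<open>y\<close> up to a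
    small error.\<close>
  obtain s :: "'a \<Rightarrow> nat" and N where s: "s ` V = {i. i < N}" "inj_on s V"
    using finite_imp_inj_to_nat_seg[OF finV] by blast
  have sN: "real (s v) \<le> real N" if "v \<in> V" for v
    using s(1) that by (auto intro: less_imp_le)
  \<comment> \<open>The displacement along \<open>y\<close> is then at most
    \<open>\<delta> / 4\<close> for all vertices at once; the added ones keep the denominator
    positive.\<close>
  define \<epsilon> where "\<epsilon> = \<delta> / (4 * (real N + 1) * (norm y + 1))"
  have "\<epsilon> > 0" using \<open>\<delta> > 0\<close> by (simp add: \<epsilon>_def add_nonneg_pos)
  have \<epsilon>: "\<epsilon> * real (s v) * norm y \<le> \<delta> / 4" if "v \<in> V" for v
  proof -
    have "\<epsilon> * real (s v) * norm y \<le> \<epsilon> * (real N + 1) * (norm y + 1)"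
      using sN[OF that] \<open>\<epsilon> > 0\<close> by (intro mult_mono) auto
    also have "\<dots> = \<delta> / 4" using norm_ge_zero[of y] by (simp add: \<epsilon>_def add_nonneg_eq_0_iff field_simps)
    finally show ?thesis .
  qed
  \<comment> \<open>The first bound controls positions. The second is for inner edges: rescaling
    divides by \<open>\<epsilon> * \<bar>k\<bar>\<close> with \<open>\<bar>k\<bar> \<ge> 1\<close>,
    so an error of at most \<open>2 * \<eta>\<close> grows to at most
    \<open>\<delta> / 2\<close>.\<close>
  define \<eta> where "\<eta> = min (\<delta> / 4) (\<epsilon> * \<delta> / 4)"
  have "\<eta> > 0" using \<open>\<delta> > 0\<close> \<open>\<epsilon> > 0\<close> by (simp add: \<eta>_def)
  obtain q where q: "generic V q" "\<And>v. v \<in> V \<Longrightarrow> dist (q v) (P0 v + (\<epsilon> * real (s v)) *\<^sub>R y) < \<eta>"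
    using generic_dense[OF finV \<open>\<eta> > 0\<close>, of "\<lambda>v. P0 v + (\<epsilon> * real (s v)) *\<^sub>R y"] by blast
  define r where "r v = q v - (P0 v + (\<epsilon> * real (s v)) *\<^sub>R y)" for v
  have r: "norm (r v) < \<eta>" if "v \<in> V" for v using q(2)[OF that] by (simp add: r_def dist_norm)
  have q_eq: "q v = P0 v + (\<epsilon> * real (s v)) *\<^sub>R y + r v" for v by (simp add: r_def)
  have near: "dist (q v) (P0 v) < \<delta> / 2" if "v \<in> V" for v
  proof -
    have "dist (q v) (P0 v) \<le> norm ((\<epsilon> * real (s v)) *\<^sub>R y) + norm (r v)"
      using norm_triangle_ineq[of "(\<epsilon> * real (s v)) *\<^sub>R y" "r v"] by (simp add: q_eq dist_norm algebra_simps)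
    also have "norm ((\<epsilon> * real (s v)) *\<^sub>R y) \<le> \<delta> / 4"
      using \<epsilon>[OF that] \<open>\<epsilon> > 0\<close> by (simp add: abs_mult)
    finally show ?thesis using r[OF that] by (simp add: \<eta>_def)
  qed
  define c where "c u v = (if idx u = idx v then 1 / (\<epsilon> * (real (s u) - real (s v))) else 1)" for u v
  have dir_near: "dist (c u v *\<^sub>R (q u - q v)) (D u v) < \<delta>" if e: "{u, v} \<in> edges G" for u v
  proof (cases "idx u = idx v")
    case True
    define k where "k = real (s u) - real (s v)"
    have uv: "u \<in> V" "v \<in> V" "u \<noteq> v" using edge[OF e] by auto
    have "s u \<noteq> s v" using uv s(2) by (auto dest: inj_onD)
    then have k: "\<bar>k\<bar> \<ge> 1" unfolding k_def by linarith
    have "q u - q v = (\<epsilon> * k) *\<^sub>R y + (r u - r v)"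
      using True by (simp add: q_eq P0_def k_def algebra_simps)
    then have "c u v *\<^sub>R (q u - q v) - D u v = (1 / (\<epsilon> * k)) *\<^sub>R (r u - r v)"
      using True k \<open>\<epsilon> > 0\<close> by (auto simp: c_def D_def k_def[symmetric] scaleR_add_right)
    then have "dist (c u v *\<^sub>R (q u - q v)) (D u v) = norm (r u - r v) / (\<epsilon> * \<bar>k\<bar>)"
      using \<open>\<epsilon> > 0\<close> by (simp add: dist_norm abs_mult)
    also have "\<dots> \<le> norm (r u - r v) / \<epsilon>"
      using k \<open>\<epsilon> > 0\<close> by (intro divide_left_mono) auto
    also have "\<dots> \<le> (2 * \<eta>) / \<epsilon>"
      using r[OF uv(1)] r[OF uv(2)] norm_triangle_ineq4[of "r u" "r v"] \<open>\<epsilon> > 0\<close>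
      by (intro divide_right_mono) auto
    also have "\<dots> \<le> \<delta> / 2"
    proof -
      have "\<eta> \<le> \<epsilon> * \<delta> / 4" by (simp add: \<eta>_def)
      then show ?thesis using \<open>\<epsilon> > 0\<close> by (simp add: field_simps)
    qed
    also have "\<dots> < \<delta>" using \<open>\<delta> > 0\<close> by simp
    finally show ?thesis .
  next
    case False
    have "dist (c u v *\<^sub>R (q u - q v)) (D u v) \<le> dist (q u) (P0 u) + dist (q v) (P0 v)"
      using False norm_triangle_ineq4[of "q u - P0 u" "q v - P0 v"]
      by (simp add: c_def D_def P0_def dist_norm algebra_simps)
    then show ?thesis using near[of u] near[of v] edge[OF e] by linarith
  qed
  have "rigid_framework G q"
  proof (rule infinitesimally_rigid_imp_rigid[OF G])
    fix f assume "infinitesimal_motion G q f"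
    moreover have "\<forall>v\<in>V. dist (q v) (P0 v) < \<delta>" using near \<open>\<delta> > 0\<close> by fastforce
    ultimately show "trivial_motion (verts G) q f"
      using \<delta>[of q c f] dir_near unfolding V_def by blast
  qed
  then show ?thesis using q(1) unfolding d_rigid_def V_def by blast
qed

end
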